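(* Let $k$ be an algebraically closed field and $d\ge 2$ an integer relatively prime to the characteristic of $k$. Let $R=k[s_2,f_2,b_{0i},b_{1i},c_{1i}\mid i=1,\dots,4]$ and let $K(2,d)\subseteq R$ be the ideal generated by $$b_{01}b_{03}^d-b_{04}b_{02}^d,\quad c_{1i}(b_{02}-b_{1i}b_{03}),\ c_{1i}(b_{01}-b_{1i}^db_{04})\ (i=1,\dots,4),\quad c_{1i}c_{1j}(b_{1i}-b_{1j})\ (1\le i<j\le 4),$$ $$b_{04}^dc_{11}-b_{01}^dc_{12},\quad b_{04}^dc_{14}-b_{01}^dc_{13},\quad b_{01}^d(c_{12}-c_{13}),\quad b_{04}^d(c_{12}b_{11}-c_{13}b_{14}),\quad b_{04}^dc_{12}(b_{12}-b_{13}).$$ Let $C_1=(c_{11},c_{12},c_{13},c_{14})$ and define $Q_{1\Lambda}=(b_{01},b_{04})+(c_{1i}\mid i\notin\Lambda)+(b_{02}-b_{1i}b_{03},\ b_{1i}-b_{1j}\mid i,j\in\Lambda)$ for $\Lambda\subseteq\{1,2,3,4\}$; $Q_2=C_1+(b_{01}b_{03}^d-b_{04}b_{02}^d)$; $Q_3=(c_{11},c_{12},c_{14},b_{01},b_{02},b_{13},b_{14})$; $Q_5=(c_{11},c_{14},b_{01},b_{02},b_{12},b_{13},c_{12}b_{11}-c_{13}b_{14})$; $Q_{17,2}=(b_{12}-b_{1i}\ (1\le i\le 4),\ c_{13}-c_{12},\ c_{11}-b_{12}^{d^2}c_{12},\ c_{14}-c_{11},\ b_{02}-b_{12}b_{03},\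 b_{01}-b_{12}^db_{04})$; $Q_{18,2}=C_1+(b_{11}-b_{1i}\ (1\le i\le4),\ b_{02}-b_{12}b_{03},\ b_{01}-b_{12}^db_{04})$; $Q_{19,2,1,\alpha}=C_1+(b_{11}-b_{14},\ b_{12}-b_{13},\ b_{02},\ b_{03},\ b_{01}-b_{12}^db_{04},\ b_{12}-\alpha b_{11})$ for $\alpha\in k$; $Q_{20}=C_1+(b_{11}-b_{14},\ b_{12}-b_{13},\ b_{01},b_{02},b_{03},b_{04})$. Then $$\mathrm{Ass}\big(R/K(2,d)\big)\subseteq\{Q_{1\Lambda'}\mid\emptyset\ne\Lambda'\subseteq\{1,2,3,4\}\}\cup\{Q_2,Q_3,Q_5,Q_{17,2},Q_{18,2},Q_{20}\}\cup\{Q_{19,2,1,\alpha}\mid\alpha^d=1\}.$$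
   Context: $\mathrm{Ass}$ denotes the set of associated primes. *)

theory Defs
  imports "HOL-Library.Poly_Mapping" "HOL-Computational_Algebra.Polynomial"
begin

definition alg_closed :: "'a::field itself \<Rightarrow> bool" where
  "alg_closed _ \<longleftrightarrow> (\<forall>p::'a poly. degree p \<ge> 1 \<longrightarrow> (\<exists>x. poly p x = 0))"

datatype idx = I1 | I2 | I3 | I4

datatype var = S2 | F2 | B0 idx | B1 idx | C1 idx

type_synonym 'a mpoly = "(var \<Rightarrow>\<^sub>0 nat) \<Rightarrow>\<^sub>0 'a"

definition Var :: "var \<Rightarrow> 'a::comm_ring_1 mpoly" where
  "Var v = Poly_Mapping.single (Poly_Mapping.single v 1) 1"

definition Const :: "'a::comm_ring_1 \<Rightarrow> 'a mpoly" where
  "Const c = Poly_Mapping.single 0 c"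

abbreviation b0 where "b0 i \<equiv> Var (B0 i)"
abbreviation b1 where "b1 i \<equiv> Var (B1 i)"
abbreviation c1 where "c1 i \<equiv> Var (C1 i)"

definition is_ideal :: "'r::comm_ring_1 set \<Rightarrow> bool" where
  "is_ideal I \<longleftrightarrow> 0 \<in> I \<and> (\<forall>a\<in>I. \<forall>b\<in>I. a + b \<in> I) \<and> (\<forall>r. \<forall>a\<in>I. r * a \<in> I)"

definition gen_ideal :: "'r::comm_ring_1 set \<Rightarrow> 'r set" where
  "gen_ideal S = \<Inter>{I. is_ideal I \<and> S \<subseteq> I}"

definition prime_ideal :: "'r::comm_ring_1 set \<Rightarrow> bool" where
  "prime_ideal P \<longleftrightarrow> is_ideal P \<and> P \<noteq> UNIV \<and> (\<forall>a b. a * b \<in> P \<longrightarrow> a \<in> P \<or> b \<in> P)"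

text \<open>Associated primes of R/I: primes of the form ann(x + I) = (I : x).\<close>
definition Ass_quot :: "'r::comm_ring_1 set \<Rightarrow> 'r set set" where
  "Ass_quot I = {P. prime_ideal P \<and> (\<exists>x. P = {r. r * x \<in> I})}"

definition K2 :: "nat \<Rightarrow> 'a::comm_ring_1 mpoly set" where
  "K2 d = gen_ideal (
     {b0 I1 * b0 I3 ^ d - b0 I4 * b0 I2 ^ d}
   \<union> {c1 i * (b0 I2 - b1 i * b0 I3) | i. True}
   \<union> {c1 i * (b0 I1 - b1 i ^ d * b0 I4) | i. True}
   \<union> {c1 i * c1 j * (b1 i - b1 j) | i j. True}
   \<union> {b0 I4 ^ d * c1 I1 - b0 I1 ^ d * c1 I2,
      b0 I4 ^ d * c1 I4 - b0 I1 ^ d * c1 I3,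
      b0 I1 ^ d * (c1 I2 - c1 I3),
      b0 I4 ^ d * (c1 I2 * b1 I1 - c1 I3 * b1 I4),
      b0 I4 ^ d * c1 I2 * (b1 I2 - b1 I3)})"

definition C1set :: "'a::comm_ring_1 mpoly set" where
  "C1set = {c1 I1, c1 I2, c1 I3, c1 I4}"

definition Q1 :: "idx set \<Rightarrow> 'a::comm_ring_1 mpoly set" where
  "Q1 L = gen_ideal ({b0 I1, b0 I4} \<union> {c1 i | i. i \<notin> L}
          \<union> {b0 I2 - b1 i * b0 I3 | i. i \<in> L} \<union> {b1 i - b1 j | i j. i \<in> L \<and> j \<in> L})"

definition Q2 :: "nat \<Rightarrow> 'a::comm_ring_1 mpoly set" where
  "Q2 d = gen_ideal (C1set \<union> {b0 I1 * b0 I3 ^ d - b0 I4 * b0 I2 ^ d})"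

definition Q3 :: "'a::comm_ring_1 mpoly set" where
  "Q3 = gen_ideal {c1 I1, c1 I2, c1 I4, b0 I1, b0 I2, b1 I3, b1 I4}"

definition Q5 :: "'a::comm_ring_1 mpoly set" where
  "Q5 = gen_ideal {c1 I1, c1 I4, b0 I1, b0 I2, b1 I2, b1 I3, c1 I2 * b1 I1 - c1 I3 * b1 I4}"

definition Q17_2 :: "nat \<Rightarrow> 'a::comm_ring_1 mpoly set" where
  "Q17_2 d = gen_ideal ({b1 I2 - b1 i | i. True}
     \<union> {c1 I3 - c1 I2, c1 I1 - b1 I2 ^ (d^2) * c1 I2, c1 I4 - c1 I1,
        b0 I2 - b1 I2 * b0 I3, b0 I1 - b1 I2 ^ d * b0 I4})"

definition Q18_2 :: "nat \<Rightarrow> 'a::comm_ring_1 mpoly set" where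
  "Q18_2 d = gen_ideal (C1set \<union> {b1 I1 - b1 i | i. True}
     \<union> {b0 I2 - b1 I2 * b0 I3, b0 I1 - b1 I2 ^ d * b0 I4})"

definition Q19 :: "nat \<Rightarrow> 'a::comm_ring_1 \<Rightarrow> 'a mpoly set" where
  "Q19 d \<alpha> = gen_ideal (C1set \<union> {b1 I1 - b1 I4, b1 I2 - b1 I3, b0 I2, b0 I3,
      b0 I1 - b1 I2 ^ d * b0 I4, b1 I2 - Const \<alpha> * b1 I1})"

definition Q20 :: "'a::comm_ring_1 mpoly set" where
  "Q20 = gen_ideal (C1set \<union> {b1 I1 - b1 I4, b1 I2 - b1 I3, b0 I1, b0 I2, b0 I3, b0 I4})"

end

theory Submission
  imports Defs
begin

text \<open>
  For every element \<open>u\<close>, an associated prime of \<open>R/I\<close> is associated to \<open>R/(I : u)\<close> or to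
  \<open>R/(I + (u))\<close>; so it suffices to climb from \<open>K2 d\<close> to the prime \<open>Q2 d\<close> by adjoining elements
  whose colon ideals are visible. Most of them are prime or have the form \<open>B + (t\<^sup>n)\<close> with \<open>B\<close> and
  \<open>B + (t)\<close> prime, and then \<open>B + (t)\<close> is the only associated prime.

  The relations \<open>b0 I1 = b1 i ^ d * b0 I4\<close>, valid after multiplication by \<open>c1 i\<close>, show that the last
  five generators of \<open>K2 d\<close> are \<open>b0 I4 ^ d\<close> times simpler elements. Together with the first
  generators these span \<open>(K2 d : b0 I4 ^ d)\<close>, because \<open>b0 I4\<close> is a nonzerodivisor modulo the first
  generators. On the other side, adjoining \<open>b0 I4 ^ d * c1 i\<close> to \<open>K2 d\<close> leaves a module that is
  graded by the monomials in the \<open>c1 i\<close>; the part with support \<open>L\<close> contributes \<open>Q1 L\<close>.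

  Above \<open>(K2 d : b0 I4 ^ d)\<close> one adjoins successively
  \<open>b1 I2 ^ d\<^sup>2 * c1 I2 * (b1 I1 - b1 I2)\<close>, \<open>b1 I2 ^ d\<^sup>2 * c1 I2\<close>, \<open>c1 I2\<close> and \<open>c1 I3\<close>. The last three steps
  contribute \<open>Q17_2 d\<close>, \<open>Q5\<close> and \<open>Q3\<close>. The first colon ideal is a prime plus the product of \<open>b0 I4\<close> and
  \<open>(b1 I2 ^ d - b1 I1 ^ d) / (b1 I2 - b1 I1)\<close>; over an algebraically closed field this product splits
  into linear factors, which give \<open>Q20\<close> and the \<open>Q19 d \<alpha>\<close>.
\<close>

section \<open>Ideals and associated primes\<close>

lemma is_ideal_gen_ideal: "is_ideal (gen_ideal S)"
  unfolding gen_ideal_def is_ideal_def by blast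

lemma gen_ideal_superset: "S \<subseteq> gen_ideal S"
  unfolding gen_ideal_def by blast

lemma gen_ideal_base: "x \<in> S \<Longrightarrow> x \<in> gen_ideal S"
  using gen_ideal_superset by blast

lemma gen_ideal_least: "is_ideal I \<Longrightarrow> S \<subseteq> I \<Longrightarrow> gen_ideal S \<subseteq> I"
  unfolding gen_ideal_def by blast

lemma is_idealD:
  assumes "is_ideal I"
  shows "0 \<in> I" "a \<in> I \<Longrightarrow> b \<in> I \<Longrightarrow> a + b \<in> I" "a \<in> I \<Longrightarrow> r * a \<in> I" "a \<in> I \<Longrightarrow> a * r \<in> I"
    "a \<in> I \<Longrightarrow> - a \<in> I" "a \<in> I \<Longrightarrow> b \<in> I \<Longrightarrow> a - b \<in> I"
proof -
  show *: "0 \<in> I" "\<And>a b. a \<in> I \<Longrightarrow> b \<in> I \<Longrightarrow> a + b \<in> I" "\<And>r a. a \<in> I \<Longrightarrow> r * a \<in> I"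
    using assms unfolding is_ideal_def by auto
  show "a \<in> I \<Longrightarrow> a * r \<in> I" using *(3) by (metis mult.commute)
  show neg: "- b \<in> I" if "b \<in> I" for b using *(3)[OF that, of "-1"] by simp
  show "a \<in> I \<Longrightarrow> b \<in> I \<Longrightarrow> a - b \<in> I" using *(2)[of a "- b"] neg by simp
qed

lemmas gen_ideal_closed = is_idealD[OF is_ideal_gen_ideal]

lemma gen_ideal_mono: "S \<subseteq> gen_ideal T \<Longrightarrow> gen_ideal S \<subseteq> gen_ideal T"
  by (rule gen_ideal_least[OF is_ideal_gen_ideal])

lemma gen_ideal_eqI: "S \<subseteq> gen_ideal T \<Longrightarrow> T \<subseteq> gen_ideal S \<Longrightarrow> gen_ideal S = gen_ideal T"
  by (simp add: gen_ideal_mono subset_antisym)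

lemma gen_ideal_cong:
  assumes "p - q \<in> gen_ideal S"
  shows "p \<in> gen_ideal S \<longleftrightarrow> q \<in> gen_ideal S"
proof
  show "q \<in> gen_ideal S" if "p \<in> gen_ideal S"
    using gen_ideal_closed(6)[OF that assms] by simp
  show "p \<in> gen_ideal S" if "q \<in> gen_ideal S"
    using gen_ideal_closed(2)[OF that assms] by simp
qed

lemma is_ideal_colon: "is_ideal I \<Longrightarrow> is_ideal {r. r * u \<in> I}"
  unfolding is_ideal_def by (auto simp: distrib_right mult.assoc)

text \<open>The elements congruent to a multiple of \<open>u\<close> modulo
  \<open>gen_ideal S\<close> form an ideal containing \<open>insert u S\<close>. This replaces
  membership in the larger ideal by an explicit coefficient, the form in which the cancellation
  arguments below are carried out.\<close>

lemma gen_ideal_insert: "x \<in> gen_ideal (insert u S) \<longleftrightarrow> (\<exists>r. x - r * u \<in> gen_ideal S)"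
proof
  have id: "is_ideal {x. \<exists>r. x - r * u \<in> gen_ideal S}"
    unfolding is_ideal_def
  proof (intro conjI ballI allI; clarsimp)
    show "\<exists>r. - (r * u) \<in> gen_ideal S" by (rule exI[of _ 0]) (simp add: gen_ideal_closed)
  next
    fix a b r s assume "a - r * u \<in> gen_ideal S" "b - s * u \<in> gen_ideal S"
    from gen_ideal_closed(2)[OF this] show "\<exists>t. a + b - t * u \<in> gen_ideal S"
      by (intro exI[of _ "r + s"]) (simp add: algebra_simps)
  next
    fix t a r assume "a - r * u \<in> gen_ideal S"
    from gen_ideal_closed(3)[OF this, of t] show "\<exists>r. t * a - r * u \<in> gen_ideal S"
      by (intro exI[of _ "t * r"]) (simp add: algebra_simps)
  qed
  have "insert u S \<subseteq> {x. \<exists>r. x - r * u \<in> gen_ideal S}"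
  proof (clarsimp, intro conjI)
    show "\<exists>r. u - r * u \<in> gen_ideal S" by (rule exI[of _ 1]) (simp add: gen_ideal_closed)
    show "S \<subseteq> {x. \<exists>r. x - r * u \<in> gen_ideal S}"
      by (auto intro!: exI[of _ 0] gen_ideal_base)
  qed
  then show "x \<in> gen_ideal (insert u S) \<Longrightarrow> \<exists>r. x - r * u \<in> gen_ideal S"
    using gen_ideal_least[OF id] by blast
next
  assume "\<exists>r. x - r * u \<in> gen_ideal S"
  then obtain r where "x - r * u \<in> gen_ideal S" by blast
  moreover have "gen_ideal S \<subseteq> gen_ideal (insert u S)"
    by (rule gen_ideal_mono) (auto intro: gen_ideal_base)
  ultimately show "x \<in> gen_ideal (insert u S)"
    using gen_ideal_closed(2)[of "x - r * u" "insert u S" "r * u"]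
      gen_ideal_closed(3)[OF gen_ideal_base[of u "insert u S"], of r] by auto
qed

text \<open>Stated for an arbitrary ideal, not only for \<open>gen_ideal S\<close>, so that it also
  applies inside colon ideals.\<close>

lemma power_diff_mem:
  assumes "is_ideal I" "p - q \<in> I"
  shows "p ^ n - q ^ n \<in> I"
proof (induction n)
  case 0
  show ?case using is_idealD(1)[OF assms(1)] by simp
next
  case (Suc n)
  have "p ^ Suc n - q ^ Suc n = p * (p ^ n - q ^ n) + (p - q) * q ^ n"
    by (simp add: algebra_simps)
  then show ?case
    using is_idealD(2)[OF assms(1) is_idealD(3)[OF assms(1) Suc] is_idealD(4)[OF assms(1,2)]]
    by simp
qed

text \<open>Since J lies in I + (u), the module J/I embeds into a cyclic module isomorphic to R/(I :
  u); the claim is Ass(M) \<subseteq> Ass(N) \<union> Ass(M/N) for M = R/I and N = J/I, proved on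
  elements. The element \<open>u\<close> itself may lie outside \<open>J\<close>; the reduction of
  \<open>K2 d\<close> relies on this.\<close>

lemma Ass_quot_insert:
  assumes I: "is_ideal I" and J: "is_ideal J" "I \<subseteq> J"
    and JI: "\<And>g. g \<in> J \<Longrightarrow> \<exists>w. g - w * u \<in> I"
  shows "Ass_quot I \<subseteq> Ass_quot {r. r * u \<in> I} \<union> Ass_quot J"
proof
  fix P assume "P \<in> Ass_quot I"
  then obtain g where pr: "prime_ideal P" and P: "P = {r. r * g \<in> I}"
    unfolding Ass_quot_def by blast
  show "P \<in> Ass_quot {r. r * u \<in> I} \<union> Ass_quot J"
  \<comment> \<open>If s \<notin> P and s g \<in> J, then s g has the same annihilator P modulo I
    because P is prime; writing s g = w u modulo I exhibits P as ((I : u) : w). If no such s exists,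
    then P = (J : g).\<close>
  proof (cases "\<exists>s. s \<notin> P \<and> s * g \<in> J")
    case True
    then obtain s where s: "s \<notin> P" "s * g \<in> J" by blast
    then obtain w where w: "s * g - w * u \<in> I" using JI by blast
    have "r \<in> P \<longleftrightarrow> r * w * u \<in> I" for r
    proof -
      have "r \<in> P \<longleftrightarrow> r * s \<in> P"
        using pr s(1) unfolding prime_ideal_def using is_idealD(4) by blast
      also have "\<dots> \<longleftrightarrow> r * s * g \<in> I" using P by simp
      also have "\<dots> \<longleftrightarrow> r * w * u \<in> I"
      proof -
        have "r * s * g - r * w * u \<in> I"
          using is_idealD(3)[OF I w, of r] by (simp add: algebra_simps)
        from is_idealD(2)[OF I _ this] is_idealD(6)[OF I _ this]
        show ?thesis by (metis add_diff_cancel_left' add_diff_eq diff_diff_eq2 )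
      qed
      finally show ?thesis .
    qed
    then have "P = {r. r * w \<in> {r. r * u \<in> I}}" by auto
    then show ?thesis using pr unfolding Ass_quot_def by blast
  next
    case False
    then have "P = {r. r * g \<in> J}" using P J(2) by auto
    then show ?thesis using pr unfolding Ass_quot_def by blast
  qed
qed

text \<open>The first two assumptions are finite checks on generators. The third says that
  \<open>u\<close> is a nonzerodivisor modulo \<open>gen_ideal Q\<close>, so r u \<in> gen_ideal S
  \<subseteq> gen_ideal Q already forces r \<in> gen_ideal Q.\<close>

lemma colon_eqI:
  assumes "S \<subseteq> gen_ideal Q" "\<And>q. q \<in> Q \<Longrightarrow> q * u \<in> gen_ideal S"
    and "\<And>p. p * u \<in> gen_ideal Q \<Longrightarrow> p \<in> gen_ideal Q"
  shows "{r. r * u \<in> gen_ideal S} = gen_ideal Q"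
proof
  show "gen_ideal Q \<subseteq> {r. r * u \<in> gen_ideal S}"
    by (rule gen_ideal_least[OF is_ideal_colon[OF is_ideal_gen_ideal]]) (use assms(2) in auto)
  show "{r. r * u \<in> gen_ideal S} \<subseteq> gen_ideal Q"
    using gen_ideal_mono[OF assms(1)] assms(3) by auto
qed

lemma Ass_quot_gen_insert:
  "Ass_quot (gen_ideal S) \<subseteq> Ass_quot {r. r * u \<in> gen_ideal S} \<union> Ass_quot (gen_ideal (insert u S))"
proof (rule Ass_quot_insert[OF is_ideal_gen_ideal is_ideal_gen_ideal])
  show "gen_ideal S \<subseteq> gen_ideal (insert u S)"
    by (rule gen_ideal_mono) (auto intro: gen_ideal_base)
qed (simp add: gen_ideal_insert)

text \<open>The colon ideal (P : g) is P for g \<notin> P, by primality, and the whole ring for g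
  \<in> P.\<close>

lemma Ass_quot_prime:
  assumes "prime_ideal P"
  shows "Ass_quot P \<subseteq> {P}"
proof
  fix Q assume "Q \<in> Ass_quot P"
  then obtain g where Q: "prime_ideal Q" "Q = {r. r * g \<in> P}" unfolding Ass_quot_def by blast
  have "g \<notin> P"
  proof
    assume "g \<in> P"
    then have "Q = UNIV" using Q(2) assms is_idealD(3) unfolding prime_ideal_def by auto
    then show False using Q(1) unfolding prime_ideal_def by simp
  qed
  then have "Q = P" using Q(2) assms is_idealD(4) unfolding prime_ideal_def by blast
  then show "Q \<in> {P}" by simp
qed

lemma Ass_quot_UNIV: "Ass_quot (UNIV :: 'r::comm_ring_1 set) = {}"
  unfolding Ass_quot_def prime_ideal_def by auto

lemma gen_ideal_one: "gen_ideal (insert 1 S) = UNIV"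
  using gen_ideal_closed(3)[OF gen_ideal_base[of 1 "insert 1 S"]] by auto

lemma gen_ideal_insert_mult:
  assumes "t * p \<in> gen_ideal (insert (t * \<pi>) B)" "prime_ideal (gen_ideal B)" "t \<notin> gen_ideal B"
  shows "p \<in> gen_ideal (insert \<pi> B)"
proof -
  obtain r where "t * p - r * (t * \<pi>) \<in> gen_ideal B" using assms(1) gen_ideal_insert by blast
  then have "t * (p - r * \<pi>) \<in> gen_ideal B" by (simp add: algebra_simps)
  then have "p - r * \<pi> \<in> gen_ideal B" using assms(2,3) unfolding prime_ideal_def by blast
  then show ?thesis using gen_ideal_insert by blast
qed

text \<open>Peel off one factor t: as t is a nonzerodivisor modulo the prime B, the colon of B + (t
  \<pi>) by t is B + (\<pi>), while adjoining t absorbs t \<pi>. The empty product gives the unit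
  ideal, which has no associated primes.\<close>

lemma Ass_quot_prod_list:
  assumes B: "prime_ideal (gen_ideal B)" and "\<And>t. t \<in> set ts \<Longrightarrow> t \<notin> gen_ideal B"
  shows "Ass_quot (gen_ideal (insert (prod_list ts) B))
           \<subseteq> (\<Union>t\<in>set ts. Ass_quot (gen_ideal (insert t B)))"
  using assms(2)
proof (induction ts)
  case Nil
  show ?case by (simp add: gen_ideal_one Ass_quot_UNIV)
next
  case (Cons t ts)
  let ?I = "gen_ideal (insert (t * prod_list ts) B)"
  have B_sub: "B \<subseteq> gen_ideal (insert x B)" for x by (auto intro: gen_ideal_base)
  have "{r. r * t \<in> ?I} = gen_ideal (insert (prod_list ts) B)"
  proof
    show "{r. r * t \<in> ?I} \<subseteq> gen_ideal (insert (prod_list ts) B)"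
      using gen_ideal_insert_mult[OF _ B Cons.prems] by (auto simp: mult.commute)
    show "gen_ideal (insert (prod_list ts) B) \<subseteq> {r. r * t \<in> ?I}"
      by (rule gen_ideal_least[OF is_ideal_colon[OF is_ideal_gen_ideal]])
         (auto simp: mult.commute intro: gen_ideal_base gen_ideal_closed)
  qed
  moreover have "gen_ideal (insert t (insert (t * prod_list ts) B)) = gen_ideal (insert t B)"
    by (rule gen_ideal_eqI) (auto intro: gen_ideal_base gen_ideal_closed)
  ultimately have "Ass_quot ?I \<subseteq> Ass_quot (gen_ideal (insert (prod_list ts) B))
      \<union> Ass_quot (gen_ideal (insert t B))"
    using Ass_quot_gen_insert[of "insert (t * prod_list ts) B" t] by simp
  with Cons show ?case by auto
qed

lemma Ass_quot_power:
  assumes "prime_ideal (gen_ideal B)" "t \<notin> gen_ideal B" "prime_ideal (gen_ideal (insert t B))"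
  shows "Ass_quot (gen_ideal (insert (t ^ n) B)) \<subseteq> {gen_ideal (insert t B)}"
proof -
  have "Ass_quot (gen_ideal (insert (t ^ n) B))
      \<subseteq> (\<Union>s\<in>set (replicate n t). Ass_quot (gen_ideal (insert s B)))"
    using Ass_quot_prod_list[OF assms(1), of "replicate n t"] assms(2)
    by (simp add: in_set_replicate)
  also have "\<dots> \<subseteq> {gen_ideal (insert t B)}" using Ass_quot_prime[OF assms(3)] by auto
  finally show ?thesis .
qed

text \<open>Induction on n: p u \<in> B + (t) gives p = s t modulo B, cancelling t gives s u in the
  ideal with one power less, and the induction hypothesis for s lifts back to p.\<close>

lemma nonzerodivisor_power:
  assumes B: "prime_ideal (gen_ideal B)" "t \<notin> gen_ideal B"
    and t: "prime_ideal (gen_ideal (insert t B))" "u \<notin> gen_ideal (insert t B)"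
  shows "p * u \<in> gen_ideal (insert (t ^ n) B) \<Longrightarrow> p \<in> gen_ideal (insert (t ^ n) B)"
proof (induction n arbitrary: p)
  case 0
  then show ?case by (simp add: gen_ideal_one)
next
  case (Suc n)
  have "gen_ideal (insert (t ^ Suc n) B) \<subseteq> gen_ideal (insert t B)"
    by (rule gen_ideal_mono) (auto intro: gen_ideal_base gen_ideal_closed)
  with Suc.prems t have "p \<in> gen_ideal (insert t B)" unfolding prime_ideal_def by blast
  then obtain s where s: "p - s * t \<in> gen_ideal B" using gen_ideal_insert by blast
  have sub: "gen_ideal B \<subseteq> gen_ideal (insert (t ^ Suc n) B)"
    by (rule gen_ideal_mono) (auto intro: gen_ideal_base)
  have "p * u - (p - s * t) * u \<in> gen_ideal (insert (t ^ Suc n) B)"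
    by (rule gen_ideal_closed(6)[OF Suc.prems]) (use s sub in \<open>auto intro: gen_ideal_closed\<close>)
  then have "t * (s * u) \<in> gen_ideal (insert (t * t ^ n) B)" by (simp add: algebra_simps)
  then have "s * u \<in> gen_ideal (insert (t ^ n) B)" by (rule gen_ideal_insert_mult[OF _ B])
  then have "s \<in> gen_ideal (insert (t ^ n) B)" by (rule Suc.IH)
  then obtain r where r: "s - r * t ^ n \<in> gen_ideal B" using gen_ideal_insert by blast
  have "(p - s * t) + t * (s - r * t ^ n) \<in> gen_ideal B"
    using s r by (intro gen_ideal_closed(2,3))
  also have "(p - s * t) + t * (s - r * t ^ n) = p - r * t ^ Suc n" by (simp add: algebra_simps)
  finally show ?case using gen_ideal_insert by blast
qed


section \<open>Substitutions in the polynomial ring\<close>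

instance idx :: finite
proof
  have "(UNIV :: idx set) = {I1, I2, I3, I4}" using idx.exhaust by auto
  then show "finite (UNIV :: idx set)" by (metis finite.emptyI finite.insertI)
qed

instance var :: finite
proof
  have "v \<in> {S2, F2} \<union> range B0 \<union> range B1 \<union> range C1" for v by (cases v) auto
  then have "(UNIV :: var set) = {S2, F2} \<union> range B0 \<union> range B1 \<union> range C1" by blast
  moreover have "finite ({S2, F2} \<union> range B0 \<union> range B1 \<union> range C1)" by simp
  ultimately show "finite (UNIV :: var set)" by metis
qed

definition var_index :: "var \<Rightarrow> nat" where
  "var_index = (SOME f. inj f)"

lemma inj_var_index: "inj var_index"
proof -
  obtain f :: "var \<Rightarrow> nat" where "inj f" using finite_imp_inj_to_nat_seg[of "UNIV :: var set"] by auto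
  then show ?thesis unfolding var_index_def by (rule someI[of inj])
qed

text \<open>Any linear order on the variables orders the monomials, which makes \<open>'a mpoly\<close> an integral
  domain.\<close>

instantiation var :: linorder
begin

definition less_eq_var :: "var \<Rightarrow> var \<Rightarrow> bool" where
  "v \<le> w \<longleftrightarrow> var_index v \<le> var_index w"

definition less_var :: "var \<Rightarrow> var \<Rightarrow> bool" where
  "v < w \<longleftrightarrow> var_index v < var_index w"

instance
  by standard (auto simp: less_eq_var_def less_var_def dest: injD[OF inj_var_index])

end

section \<open>Monomial expansions and substitution endomorphisms\<close>

lemma poly_mapping_sum_single:
  "(p :: 'k \<Rightarrow>\<^sub>0 'b::comm_monoid_add) = (\<Sum>m\<in>Poly_Mapping.keys p. Poly_Mapping.single m (Poly_Mapping.lookup p m))"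
  by (rule poly_mapping_eqI) (auto simp: lookup_sum lookup_single when_def in_keys_iff)

lemma poly_mapping_single_induct:
  assumes "\<And>m c. P (Poly_Mapping.single m c)" "\<And>p q. P p \<Longrightarrow> P q \<Longrightarrow> P (p + q)"
  shows "P (p :: 'k \<Rightarrow>\<^sub>0 'b::comm_monoid_add)"
proof -
  have "P (\<Sum>m\<in>M. Poly_Mapping.single m (Poly_Mapping.lookup p m))" if "finite M" for M
    using that
  proof (induction M rule: finite_induct)
    case empty
    show ?case using assms(1)[of undefined 0] by simp
  qed (simp add: assms)
  then show ?thesis using poly_mapping_sum_single[of p] by (metis finite_keys)
qed

definition eval_mon :: "(var \<Rightarrow> 'a::comm_ring_1 mpoly) \<Rightarrow> (var \<Rightarrow>\<^sub>0 nat) \<Rightarrow> 'a mpoly" where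
  "eval_mon \<sigma> m = (\<Prod>v\<in>UNIV. \<sigma> v ^ Poly_Mapping.lookup m v)"

text \<open>The endomorphism over the coefficient ring with Var v \<mapsto> \<sigma> v. Kernels of
  such maps serve both to prove ideals prime and to show that elements lie outside them.\<close>

definition subst :: "(var \<Rightarrow> 'a::comm_ring_1 mpoly) \<Rightarrow> 'a mpoly \<Rightarrow> 'a mpoly" where
  "subst \<sigma> p = (\<Sum>m\<in>Poly_Mapping.keys p. Const (Poly_Mapping.lookup p m) * eval_mon \<sigma> m)"

lemma Const_0 [simp]: "Const 0 = 0"
  and Const_1 [simp]: "Const 1 = 1"
  and Const_add: "Const (a + b) = Const a + Const b"
  and Const_mult: "Const (a * b) = Const a * Const b"
  by (simp_all add: Const_def single_add mult_single)

lemma eval_mon_add: "eval_mon \<sigma> (m + n) = eval_mon \<sigma> m * eval_mon \<sigma> n"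
  unfolding eval_mon_def by (simp add: lookup_add power_add prod.distrib)

lemma subst_superset:
  assumes "finite A" "Poly_Mapping.keys p \<subseteq> A"
  shows "subst \<sigma> p = (\<Sum>m\<in>A. Const (Poly_Mapping.lookup p m) * eval_mon \<sigma> m)"
  unfolding subst_def by (rule sum.mono_neutral_left) (use assms in \<open>auto simp: in_keys_iff\<close>)

lemma subst_single: "subst \<sigma> (Poly_Mapping.single m c) = Const c * eval_mon \<sigma> m"
  by (subst subst_superset[of "{m}"]) auto

lemma subst_add [simp]: "subst \<sigma> (p + q) = subst \<sigma> p + subst \<sigma> q"
proof -
  let ?A = "Poly_Mapping.keys p \<union> Poly_Mapping.keys q"
  have "subst \<sigma> r = (\<Sum>m\<in>?A. Const (Poly_Mapping.lookup r m) * eval_mon \<sigma> m)"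
    if "r \<in> {p, q, p + q}" for r
    by (rule subst_superset) (use that keys_add[of p q] in auto)
  then show ?thesis by (simp add: lookup_add Const_add distrib_right sum.distrib)
qed

lemma subst_mult [simp]: "subst \<sigma> (p * q) = subst \<sigma> p * subst \<sigma> q"
proof (induction p rule: poly_mapping_single_induct)
  case (1 m c)
  show ?case
    by (induction q rule: poly_mapping_single_induct)
       (simp_all add: mult_single subst_single eval_mon_add Const_mult algebra_simps)
qed (simp add: distrib_right)

lemma subst_Const [simp]: "subst \<sigma> (Const c) = Const c"
  unfolding Const_def[of c] subst_single by (simp add: eval_mon_def Const_def)

lemma subst_0 [simp]: "subst \<sigma> 0 = 0"
  and subst_1 [simp]: "subst \<sigma> 1 = 1"
  using subst_Const[of \<sigma> 0] subst_Const[of \<sigma> 1] by simp_all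

lemma subst_Var [simp]: "subst \<sigma> (Var v) = \<sigma> v"
proof -
  have "eval_mon \<sigma> (Poly_Mapping.single v 1) = (\<Prod>w\<in>UNIV. if w = v then \<sigma> v else 1)"
    unfolding eval_mon_def by (rule prod.cong) (auto simp: lookup_single when_def)
  then show ?thesis by (simp add: Var_def subst_single)
qed

lemma subst_uminus [simp]: "subst \<sigma> (- p) = - subst \<sigma> p"
  using subst_add[of \<sigma> p "- p"] by (simp add: eq_neg_iff_add_eq_0 add.commute)

lemma subst_diff [simp]: "subst \<sigma> (p - q) = subst \<sigma> p - subst \<sigma> q"
  using subst_add[of \<sigma> p "- q"] by simp

lemma subst_power [simp]: "subst \<sigma> (p ^ n) = subst \<sigma> p ^ n"
  by (induction n) simp_all

lemma subst_prod [simp]: "subst \<sigma> (\<Prod>i\<in>A. f i) = (\<Prod>i\<in>A. subst \<sigma> (f i))"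
  by (induction A rule: infinite_finite_induct) simp_all

lemma subst_sum [simp]: "subst \<sigma> (\<Sum>i\<in>A. f i) = (\<Sum>i\<in>A. subst \<sigma> (f i))"
  by (induction A rule: infinite_finite_induct) simp_all

lemma single_one_power:
  "Poly_Mapping.single k (1 :: 'a::comm_ring_1) ^ n = Poly_Mapping.single (\<Sum>i<n. k) 1"
  by (induction n) (simp_all add: mult_single add.commute)

lemma single_one_prod:
  "(\<Prod>i\<in>A. Poly_Mapping.single (k i) (1 :: 'a::comm_ring_1)) = Poly_Mapping.single (\<Sum>i\<in>A. k i) 1"
  by (induction A rule: infinite_finite_induct) (simp_all add: mult_single)

lemma eval_mon_single:
  "eval_mon (\<lambda>v. Poly_Mapping.single (g v) 1) m
     = Poly_Mapping.single (\<Sum>v\<in>UNIV. \<Sum>i<Poly_Mapping.lookup m v. g v) 1"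
  unfolding eval_mon_def by (simp add: single_one_power single_one_prod)

lemma single_eq_prod: "Poly_Mapping.single m c = Const c * (\<Prod>v\<in>UNIV. Var v ^ Poly_Mapping.lookup m v)"
proof -
  have "(\<Sum>v\<in>UNIV. \<Sum>i<Poly_Mapping.lookup m v. Poly_Mapping.single v (1 :: nat)) = m"
    by (rule poly_mapping_eqI) (simp add: lookup_sum lookup_single when_def if_distrib[of "(*) _"] cong: if_cong)
  then have "(\<Prod>v\<in>UNIV. Var v ^ Poly_Mapping.lookup m v) = Poly_Mapping.single m (1 :: 'a)"
    using eval_mon_single[of "\<lambda>v. Poly_Mapping.single v 1" m]
    by (simp add: eval_mon_def Var_def)
  then show ?thesis by (simp add: Const_def mult_single)
qed

lemma mpoly_induct [case_names Const Var add mult]: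
  assumes Const: "\<And>c. P (Const c)" and Var: "\<And>v. P (Var v)"
    and add: "\<And>p q. P p \<Longrightarrow> P q \<Longrightarrow> P (p + q)" and mult: "\<And>p q. P p \<Longrightarrow> P q \<Longrightarrow> P (p * q)"
  shows "P (p :: 'a::comm_ring_1 mpoly)"
proof (induction p rule: poly_mapping_single_induct)
  case (1 m c)
  have one: "P 1" using Const[of 1] by simp
  have pow: "P (q ^ n)" if "P q" for q n
    by (induction n) (simp_all add: one that mult)
  have "P (\<Prod>v\<in>V. Var v ^ Poly_Mapping.lookup m v)" for V
    by (induction V rule: infinite_finite_induct) (simp_all add: one pow Var mult)
  then show ?case unfolding single_eq_prod by (intro mult Const)
qed (rule add)

text \<open>Congruence modulo \<open>I\<close> respects sums and products, so it spreads from the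
  variables to all polynomials.\<close>

lemma subst_cong_ideal:
  assumes I: "is_ideal I" and "\<And>v. Var v - \<sigma> v \<in> I"
  shows "p - subst \<sigma> p \<in> I"
proof (induction p rule: mpoly_induct)
  case (Const c)
  show ?case using is_idealD(1)[OF I] by simp
next
  case (Var v)
  show ?case using assms(2) by simp
next
  case (add p q)
  show ?case using is_idealD(2)[OF I add] by (simp add: algebra_simps)
next
  case (mult p q)
  have "p * q - subst \<sigma> (p * q) = (p - subst \<sigma> p) * q + subst \<sigma> p * (q - subst \<sigma> q)"
    by (simp add: algebra_simps)
  then show ?case
    using is_idealD(2)[OF I is_idealD(4)[OF I mult(1)] is_idealD(3)[OF I mult(2)]] by simp
qed

lemma is_ideal_ker_subst: "is_ideal {p. subst \<sigma> p = 0}"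
  unfolding is_ideal_def by simp

text \<open>The map \<open>f\<close> is left abstract so that it may also be a composite of two
  substitutions, as in the binomial case below.\<close>

lemma prime_ideal_ker:
  assumes "\<And>p q. f (p * q) = f p * (f q :: 'b::idom)" "f 1 \<noteq> 0" "is_ideal {p. f p = 0}"
  shows "prime_ideal {p. f p = 0}"
  using assms unfolding prime_ideal_def by auto

text \<open>For p in the kernel, p = p - subst \<sigma> p, which lies in the ideal because every
  variable is congruent to its image. The other inclusion is a check on generators.\<close>

lemma gen_ideal_retraction:
  assumes ker: "\<And>s. s \<in> S \<Longrightarrow> subst \<sigma> s = 0" and cong: "\<And>v. Var v - \<sigma> v \<in> gen_ideal S"
  shows "gen_ideal S = {p. subst \<sigma> p = 0}"
proof
  show "gen_ideal S \<subseteq> {p. subst \<sigma> p = 0}"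
    by (rule gen_ideal_least[OF is_ideal_ker_subst]) (use ker in auto)
  show "{p. subst \<sigma> p = 0} \<subseteq> gen_ideal S"
    using subst_cong_ideal[OF is_ideal_gen_ideal cong] by (auto dest: spec)
      (metis diff_zero)
qed

lemma prime_retraction:
  assumes "\<And>s. s \<in> S \<Longrightarrow> subst \<sigma> s = 0" "\<And>v. Var v - \<sigma> v \<in> gen_ideal S"
  shows "prime_ideal (gen_ideal S :: 'a::field mpoly set)"
  unfolding gen_ideal_retraction[OF assms, simplified]
  by (rule prime_ideal_ker) (simp_all add: is_ideal_ker_subst)

section \<open>Polynomials that do not involve a given variable\<close>

definition free_of :: "var \<Rightarrow> 'a::comm_ring_1 mpoly \<Rightarrow> bool" where
  "free_of t p \<longleftrightarrow> (\<forall>m\<in>Poly_Mapping.keys p. Poly_Mapping.lookup m t = 0)"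

lemma free_of_Const: "free_of t (Const c)"
  by (simp add: free_of_def Const_def)

lemma free_of_Var: "v \<noteq> t \<Longrightarrow> free_of t (Var v)"
  by (simp add: free_of_def Var_def lookup_single)

lemma free_of_add: "free_of t p \<Longrightarrow> free_of t q \<Longrightarrow> free_of t (p + q)"
  using keys_add[of p q] unfolding free_of_def by blast

lemma free_of_mult: "free_of t p \<Longrightarrow> free_of t q \<Longrightarrow> free_of t (p * q)"
  using keys_mult[of p q] unfolding free_of_def by (fastforce simp: lookup_add)

lemma free_of_0 [simp]: "free_of t 0"
  by (simp add: free_of_def)

lemma free_of_power: "free_of t p \<Longrightarrow> free_of t (p ^ n)"
  by (induction n) (simp_all add: free_of_mult free_of_Const[of t 1, simplified])

lemma free_of_subst:
  assumes "\<And>v. free_of t (\<sigma> v)"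
  shows "free_of t (subst \<sigma> p)"
  by (induction p rule: mpoly_induct)
     (simp_all add: free_of_Const assms free_of_add free_of_mult)

section \<open>Primes generated by a binomial and a retraction\<close>

lemma Var_power: "Var v ^ k = Poly_Mapping.single (Poly_Mapping.single v k) (1 :: 'a::comm_ring_1)"
proof -
  have "(\<Sum>i<k. Poly_Mapping.single v (1 :: nat)) = Poly_Mapping.single v k"
    by (rule poly_mapping_eqI) (simp add: lookup_sum lookup_single when_def)
  then show ?thesis by (simp add: Var_def single_one_power)
qed

text \<open>Setting for the binomial A Y^n - E X^n, whose zero set is parametrised by A \<mapsto> T
  X^n, E \<mapsto> T Y^n. The parameter T is borrowed from the existing variables, so the
  polynomials treated must be free of it.\<close>

locale toric =
  fixes A E X Y T :: var and n :: nat
  assumes distinct: "distinct [A, E, X, Y, T]" and n: "n \<ge> 1"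
begin

lemma neqs: "A \<noteq> E" "A \<noteq> X" "A \<noteq> Y" "A \<noteq> T" "E \<noteq> X" "E \<noteq> Y" "E \<noteq> T" "X \<noteq> Y" "X \<noteq> T" "Y \<noteq> T"
    "E \<noteq> A" "X \<noteq> A" "Y \<noteq> A" "T \<noteq> A" "X \<noteq> E" "Y \<noteq> E" "T \<noteq> E" "Y \<noteq> X" "T \<noteq> X" "T \<noteq> Y"
  using distinct by auto

definition rel :: "'a::field mpoly" where
  "rel = Var A * Var Y ^ n - Var E * Var X ^ n"

definition \<tau> :: "var \<Rightarrow> 'a::field mpoly" where
  "\<tau> v = (if v = A then Var T * Var X ^ n else if v = E then Var T * Var Y ^ n else Var v)"

definition expo :: "var \<Rightarrow> var \<Rightarrow>\<^sub>0 nat" where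
  "expo v = (if v = A then Poly_Mapping.single T 1 + Poly_Mapping.single X n
    else if v = E then Poly_Mapping.single T 1 + Poly_Mapping.single Y n
    else Poly_Mapping.single v 1)"

definition expo_mon :: "(var \<Rightarrow>\<^sub>0 nat) \<Rightarrow> var \<Rightarrow>\<^sub>0 nat" where
  "expo_mon m = (\<Sum>v\<in>UNIV. \<Sum>i<Poly_Mapping.lookup m v. expo v)"

text \<open>Exponents of the monomials free of T and not divisible by A Y^n: the normal forms for
  rewriting A Y^n to E X^n.\<close>

definition normal :: "(var \<Rightarrow>\<^sub>0 nat) set" where
  "normal = {m. Poly_Mapping.lookup m T = 0 \<and> (Poly_Mapping.lookup m A = 0 \<or> Poly_Mapping.lookup m Y < n)}"

lemma \<tau>_single: "\<tau> = (\<lambda>v. Poly_Mapping.single (expo v) (1 :: 'a::field))"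
  unfolding \<tau>_def expo_def Var_power by (auto simp: Var_def mult_single)

lemma subst_\<tau>_single: "subst \<tau> (Poly_Mapping.single m c) = Poly_Mapping.single (expo_mon m) c"
  unfolding subst_single \<tau>_single eval_mon_single expo_mon_def
  by (simp add: Const_def mult_single)

lemma lookup_expo_mon:
  "Poly_Mapping.lookup (expo_mon m) w =
     Poly_Mapping.lookup m A * Poly_Mapping.lookup (expo A) w
   + Poly_Mapping.lookup m E * Poly_Mapping.lookup (expo E) w
   + (if w = A \<or> w = E then 0 else Poly_Mapping.lookup m w)"
proof -
  have "Poly_Mapping.lookup (expo_mon m) w
      = (\<Sum>v\<in>UNIV. Poly_Mapping.lookup m v * Poly_Mapping.lookup (expo v) w)"
    unfolding expo_mon_def by (simp add: lookup_sum)
  also have "\<dots> = (\<Sum>v\<in>UNIV. (if v = A then Poly_Mapping.lookup m A * Poly_Mapping.lookup (expo A) w else 0)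
      + (if v = E then Poly_Mapping.lookup m E * Poly_Mapping.lookup (expo E) w else 0)
      + (if v = w then (if w = A \<or> w = E then 0 else Poly_Mapping.lookup m w) else 0))"
    by (rule sum.cong) (use distinct in \<open>auto simp: expo_def lookup_add lookup_single when_def\<close>)
  finally show ?thesis by (simp add: sum.distrib)
qed

text \<open>Comparing exponents of T, a smaller exponent of A in m forces a larger exponent of E, by
  at least 1. In the exponent of Y this contributes at least n more on the side of m, but m' is
  normal with A present, so its own Y-exponent is below n and cannot compensate.\<close>

lemma expo_mon_inj_aux:
  assumes "m \<in> normal" "m' \<in> normal" "expo_mon m = expo_mon m'"
  shows "\<not> Poly_Mapping.lookup m A < Poly_Mapping.lookup m' A"
proof
  assume less: "Poly_Mapping.lookup m A < Poly_Mapping.lookup m' A"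
  have eq: "Poly_Mapping.lookup (expo_mon m) w = Poly_Mapping.lookup (expo_mon m') w" for w
    using assms(3) by simp
  have "Poly_Mapping.lookup m A + Poly_Mapping.lookup m E
      = Poly_Mapping.lookup m' A + Poly_Mapping.lookup m' E"
    using eq[of T] neqs assms(1,2)
    by (simp add: lookup_expo_mon expo_def lookup_add lookup_single when_def normal_def)
  then have "Suc (Poly_Mapping.lookup m' E) \<le> Poly_Mapping.lookup m E" using less by simp
  then have "n * Suc (Poly_Mapping.lookup m' E) \<le> n * Poly_Mapping.lookup m E"
    by (rule mult_le_mono2)
  moreover have "Poly_Mapping.lookup m' Y < n" using assms(2) less by (auto simp: normal_def)
  moreover have "Poly_Mapping.lookup m E * n + Poly_Mapping.lookup m Y
      = Poly_Mapping.lookup m' E * n + Poly_Mapping.lookup m' Y"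
    using eq[of Y] neqs
    by (simp add: lookup_expo_mon expo_def lookup_add lookup_single when_def)
  ultimately show False by (simp add: mult.commute)
qed

lemma inj_on_expo_mon: "inj_on expo_mon normal"
proof (rule inj_onI, rule poly_mapping_eqI)
  fix m m' w assume *: "m \<in> normal" "m' \<in> normal" "expo_mon m = expo_mon m'"
  then have A: "Poly_Mapping.lookup m A = Poly_Mapping.lookup m' A"
    using expo_mon_inj_aux[of m m'] expo_mon_inj_aux[of m' m] by auto
  have eq: "Poly_Mapping.lookup (expo_mon m) w = Poly_Mapping.lookup (expo_mon m') w" for w
    using *(3) by simp
  have E: "Poly_Mapping.lookup m E = Poly_Mapping.lookup m' E"
    using eq[of T] neqs *(1,2) A
    by (simp add: lookup_expo_mon expo_def lookup_add lookup_single when_def normal_def)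
  show "Poly_Mapping.lookup m w = Poly_Mapping.lookup m' w"
    using eq[of w] A E by (auto simp: lookup_expo_mon split: if_splits)
qed

text \<open>Distinct normal monomials have distinct images under \<tau>, so nothing cancels and each
  coefficient of p reappears in the image.\<close>

lemma subst_\<tau>_eq_0:
  assumes p: "Poly_Mapping.keys p \<subseteq> normal" "subst \<tau> p = 0"
  shows "p = 0"
proof (rule ccontr)
  assume "p \<noteq> 0"
  then obtain m where m: "m \<in> Poly_Mapping.keys p" 
    by (metis all_not_in_conv in_keys_iff lookup_zero poly_mapping_eqI)
  have "subst \<tau> p = subst \<tau> (\<Sum>k\<in>Poly_Mapping.keys p. Poly_Mapping.single k (Poly_Mapping.lookup p k))"
    by (simp add: poly_mapping_sum_single[symmetric])
  also have "\<dots> = (\<Sum>k\<in>Poly_Mapping.keys p. Poly_Mapping.single (expo_mon k) (Poly_Mapping.lookup p k))"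
    by (simp add: subst_\<tau>_single)
  finally have "Poly_Mapping.lookup (subst \<tau> p) (expo_mon m)
      = (\<Sum>k\<in>Poly_Mapping.keys p. Poly_Mapping.lookup p k when expo_mon k = expo_mon m)"
    by (simp add: lookup_sum lookup_single)
  also have "\<dots> = (\<Sum>k\<in>Poly_Mapping.keys p. if k = m then Poly_Mapping.lookup p m else 0)"
    by (rule sum.cong) (use m p(1) inj_onD[OF inj_on_expo_mon] in \<open>auto simp: when_def\<close>)
  also have "\<dots> = Poly_Mapping.lookup p m" using m by simp
  finally show False using p(2) m by (simp add: in_keys_iff)
qed

text \<open>Each replacement of a factor A Y^n by E X^n lowers the exponent of A by one, which is
  the induction measure.\<close>

lemma normal_form_monomial:
  assumes "Poly_Mapping.lookup m T = 0"
  shows "\<exists>m'\<in>normal. Poly_Mapping.single m c - Poly_Mapping.single m' c \<in> gen_ideal {rel}"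
  using assms
proof (induction "Poly_Mapping.lookup m A" arbitrary: m)
  case 0
  then show ?case
    by (intro bexI[of _ m]) (simp_all add: normal_def gen_ideal_closed)
next
  case (Suc k)
  show ?case
  proof (cases "Poly_Mapping.lookup m Y < n")
    case True
    then show ?thesis using Suc.prems
      by (intro bexI[of _ m]) (simp_all add: normal_def gen_ideal_closed)
  next
    case False
    define m0 where "m0 = m - (Poly_Mapping.single A 1 + Poly_Mapping.single Y n)"
    define m1 where "m1 = m0 + (Poly_Mapping.single E 1 + Poly_Mapping.single X n)"
    have m: "m = m0 + (Poly_Mapping.single A 1 + Poly_Mapping.single Y n)"
      by (rule poly_mapping_eqI)
         (use False Suc(2) neqs in \<open>auto simp: m0_def lookup_add lookup_minus lookup_single when_def\<close>)
    have "Poly_Mapping.lookup m1 A = k" "Poly_Mapping.lookup m1 T = 0"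
      using Suc(2) Suc.prems neqs
      by (auto simp: m m1_def lookup_add lookup_single when_def)
    then obtain m' where m': "m' \<in> normal"
        "Poly_Mapping.single m1 c - Poly_Mapping.single m' c \<in> gen_ideal {rel}"
      using Suc(1)[of m1] by auto
    have "Poly_Mapping.single m c - Poly_Mapping.single m1 c = Poly_Mapping.single m0 c * rel"
      unfolding rel_def Var_power by (simp add: Var_def m m1_def mult_single algebra_simps)
    also have "\<dots> \<in> gen_ideal {rel}" by (simp add: gen_ideal_closed gen_ideal_base)
    finally show ?thesis using gen_ideal_closed(2)[OF _ m'(2)] m'(1) by force
  qed
qed

lemma normal_form:
  assumes "free_of T p"
  shows "\<exists>q. Poly_Mapping.keys q \<subseteq> normal \<and> p - q \<in> gen_ideal {rel}"
proof -
  have "\<exists>q. Poly_Mapping.keys q \<subseteq> normal \<and>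
      (\<Sum>m\<in>M. Poly_Mapping.single m (Poly_Mapping.lookup p m)) - q \<in> gen_ideal {rel}"
    if "finite M" "\<forall>m\<in>M. Poly_Mapping.lookup m T = 0" for M
    using that
  proof (induction M rule: finite_induct)
    case empty
    show ?case by (rule exI[of _ 0]) (simp add: gen_ideal_closed)
  next
    case (insert m M)
    then obtain q where q: "Poly_Mapping.keys q \<subseteq> normal"
        "(\<Sum>m\<in>M. Poly_Mapping.single m (Poly_Mapping.lookup p m)) - q \<in> gen_ideal {rel}"
      by auto
    obtain m' where m': "m' \<in> normal" "Poly_Mapping.single m (Poly_Mapping.lookup p m)
        - Poly_Mapping.single m' (Poly_Mapping.lookup p m) \<in> gen_ideal {rel}"
      using normal_form_monomial insert.prems by blast
    show ?case
    proof (intro exI conjI)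
      show "Poly_Mapping.keys (q + Poly_Mapping.single m' (Poly_Mapping.lookup p m)) \<subseteq> normal"
        using q(1) m'(1) keys_add[of q "Poly_Mapping.single m' (Poly_Mapping.lookup p m)"]
        by (auto split: if_splits)
      show "(\<Sum>m\<in>insert m M. Poly_Mapping.single m (Poly_Mapping.lookup p m))
          - (q + Poly_Mapping.single m' (Poly_Mapping.lookup p m)) \<in> gen_ideal {rel}"
        using gen_ideal_closed(2)[OF q(2) m'(2)] insert.hyps by (simp add: algebra_simps)
    qed
  qed
  from this[of "Poly_Mapping.keys p"] assms show ?thesis
    by (simp add: poly_mapping_sum_single[symmetric] free_of_def)
qed

text \<open>The ideal is the kernel of \<tau> after \<sigma>. If \<tau> kills subst \<sigma> p,
  which is free of T, then its normal form q modulo \<open>rel\<close> is also killed, hence q = 0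
  and subst \<sigma> p is a multiple of \<open>rel\<close>; finally p differs from subst \<sigma> p
  by an element of \<open>gen_ideal S\<close>.\<close>

lemma prime_ideal_rel:
  assumes ker: "\<And>s. s \<in> S \<Longrightarrow> subst \<sigma> s = 0" and cong: "\<And>v. Var v - \<sigma> v \<in> gen_ideal S"
    and free: "\<And>v. free_of T (\<sigma> v)"
    and fixed: "\<sigma> A = Var A" "\<sigma> E = Var E" "\<sigma> X = Var X" "\<sigma> Y = Var Y"
  shows "prime_ideal (gen_ideal (insert rel S) :: 'a::field mpoly set)"
proof -
  let ?f = "\<lambda>p :: 'a mpoly. subst \<tau> (subst \<sigma> p)"
  have "gen_ideal (insert rel S) = {p. ?f p = 0}"
  proof
    show "gen_ideal (insert rel S) \<subseteq> {p. ?f p = 0}"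
    proof (rule gen_ideal_least)
      show "is_ideal {p. ?f p = 0}" unfolding is_ideal_def by simp
      show "insert rel S \<subseteq> {p. ?f p = 0}"
        using neqs by (auto simp: ker rel_def fixed \<tau>_def algebra_simps)
    qed
    show "{p. ?f p = 0} \<subseteq> gen_ideal (insert rel S)"
    proof clarify
      fix p assume p: "?f p = 0"
      obtain q where q: "Poly_Mapping.keys q \<subseteq> normal" "subst \<sigma> p - q \<in> gen_ideal {rel}"
        using normal_form[OF free_of_subst[of T \<sigma>, OF free], of p] by blast
      have "gen_ideal {rel} \<subseteq> {p :: 'a mpoly. subst \<tau> p = 0}"
        by (rule gen_ideal_least[OF is_ideal_ker_subst])
           (use neqs in \<open>auto simp: rel_def \<tau>_def algebra_simps\<close>)
      then have "subst \<tau> q = 0" using q(2) p by auto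
      then have "subst \<sigma> p \<in> gen_ideal {rel}" using subst_\<tau>_eq_0[OF q(1)] q(2) by simp
      moreover have "gen_ideal {rel} \<subseteq> gen_ideal (insert rel S)"
        "gen_ideal S \<subseteq> gen_ideal (insert rel S)"
        by (auto intro!: gen_ideal_mono intro: gen_ideal_base)
      ultimately show "p \<in> gen_ideal (insert rel S)"
        using subst_cong_ideal[OF is_ideal_gen_ideal cong, of p]
          gen_ideal_closed(2)[of "p - subst \<sigma> p" _ "subst \<sigma> p"] by auto
    qed
  qed
  then show ?thesis
    using prime_ideal_ker[of ?f] is_ideal_gen_ideal[of "insert rel S"] by simp
qed

end


section \<open>The filtration by monomials in the variables \<open>c1 i\<close>\<close>

text \<open>This rule and the next two take membership certificates: the coefficients are supplied
  explicitly at each use, and only a polynomial identity remains to be verified.\<close>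

lemma gen_ideal_comb1: "f \<in> gen_ideal S \<Longrightarrow> t = r * f \<Longrightarrow> t \<in> gen_ideal S"
  by (simp add: gen_ideal_closed)

lemma gen_ideal_comb2: "f \<in> gen_ideal S \<Longrightarrow> g \<in> gen_ideal S \<Longrightarrow> t = r * f + s * g \<Longrightarrow> t \<in> gen_ideal S"
  by (simp add: gen_ideal_closed)

lemma gen_ideal_comb3: "f \<in> gen_ideal S \<Longrightarrow> g \<in> gen_ideal S \<Longrightarrow> h \<in> gen_ideal S \<Longrightarrow> t = r * f + s * g + q * h
    \<Longrightarrow> t \<in> gen_ideal S"
  by (simp add: gen_ideal_closed)

text \<open>This is \<open>power_diff_mem\<close> inside the colon ideal of
  \<open>gen_ideal S\<close> by \<open>u\<close>.\<close>

lemma gen_ideal_power_diff: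
  assumes "u * (p - q) \<in> gen_ideal S"
  shows "u * (p ^ n - q ^ n) \<in> gen_ideal S"
  using power_diff_mem[OF is_ideal_colon[OF is_ideal_gen_ideal], of p q u S n] assms
  by (simp add: mult.commute)

lemma notin_gen_ideal:
  assumes "\<And>s. s \<in> S \<Longrightarrow> subst \<sigma> s = 0" "subst \<sigma> p \<noteq> 0"
  shows "p \<notin> gen_ideal S"
  using gen_ideal_least[OF is_ideal_ker_subst, of S \<sigma>] assms by auto

lemma Var_nonzero [simp]: "Var v \<noteq> (0 :: 'a::field mpoly)"
  unfolding Var_def by (metis lookup_single_eq lookup_zero zero_neq_one)

section \<open>The ideals of the filtration and their colon ideals\<close>

definition K_base_gens :: "nat \<Rightarrow> 'a::comm_ring_1 mpoly set" where
  "K_base_gens d = {b0 I1 * b0 I3 ^ d - b0 I4 * b0 I2 ^ d}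
   \<union> {c1 i * (b0 I2 - b1 i * b0 I3) | i. True}
   \<union> {c1 i * (b0 I1 - b1 i ^ d * b0 I4) | i. True}
   \<union> {c1 i * c1 j * (b1 i - b1 j) | i j. True}"

definition cprod :: "idx set \<Rightarrow> 'a::comm_ring_1 mpoly" where
  "cprod L = (\<Prod>i\<in>L. c1 i)"

text \<open>The family \<open>U\<close> records the supports of the monomials already adjoined. The
  parameter \<epsilon> will be 0 for the cancellation of \<open>b0 I4\<close> and a power of
  \<open>b0 I4\<close> for the associated primes.\<close>

definition filt_gens :: "nat \<Rightarrow> 'a::comm_ring_1 mpoly \<Rightarrow> idx set set \<Rightarrow> 'a mpoly set" where
  "filt_gens d \<epsilon> U = K_base_gens d \<union> {\<epsilon> * c1 i | i. True} \<union> cprod ` U"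

text \<open>For nonempty L, these are the conditions that \<open>K_base_gens d\<close> imposes where
  the \<open>c1 i\<close> with i \<in> L are invertible and the others vanish. Adjoining
  \<open>b0 I4\<close> gives \<open>Q1 L\<close>.\<close>

definition Q1_base :: "nat \<Rightarrow> idx set \<Rightarrow> 'a::comm_ring_1 mpoly set" where
  "Q1_base d L = {c1 i | i. i \<notin> L} \<union> {b0 I2 - b1 i * b0 I3 | i. i \<in> L}
     \<union> {b0 I1 - b1 i ^ d * b0 I4 | i. i \<in> L} \<union> {b1 i - b1 j | i j. i \<in> L \<and> j \<in> L}"

definition Q1_subst :: "nat \<Rightarrow> idx set \<Rightarrow> idx \<Rightarrow> var \<Rightarrow> 'a::comm_ring_1 mpoly" where
  "Q1_subst d L k v = (case v of C1 i \<Rightarrow> if i \<in> L then c1 i else 0 | B1 i \<Rightarrow> if i \<in> L then b1 k else b1 i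
     | B0 I1 \<Rightarrow> b1 k ^ d * b0 I4 | B0 I2 \<Rightarrow> b1 k * b0 I3 | _ \<Rightarrow> Var v)"

lemma Q1_subst_cong:
  assumes "k \<in> L"
  shows "Var v - Q1_subst d L k v \<in> gen_ideal (Q1_base d L)"
proof -
  have *: "b1 i - b1 k \<in> gen_ideal (Q1_base d L)" if "i \<in> L" for i
    using that assms by (intro gen_ideal_base) (auto simp: Q1_base_def)
  have "b0 I2 - b1 k * b0 I3 \<in> gen_ideal (Q1_base d L)" "b0 I1 - b1 k ^ d * b0 I4 \<in> gen_ideal (Q1_base d L)"
    "\<And>i. i \<notin> L \<Longrightarrow> c1 i \<in> gen_ideal (Q1_base d L)"
    using assms by (auto intro!: gen_ideal_base simp: Q1_base_def)
  with * show ?thesis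
    by (auto simp: Q1_subst_def gen_ideal_closed split: var.split idx.split)
qed

lemma Q1_subst_K_base: "s \<in> K_base_gens d \<Longrightarrow> subst (Q1_subst d L k) s = 0"
  by (auto simp: K_base_gens_def Q1_subst_def power_mult_distrib)

lemma Q1_subst_base: "s \<in> Q1_base d L \<Longrightarrow> subst (Q1_subst d L k) s = 0"
  by (auto simp: Q1_base_def Q1_subst_def)

lemma gen_ideal_Q1_base: "k \<in> L \<Longrightarrow> gen_ideal (Q1_base d L) = {p. subst (Q1_subst d L k) p = 0}"
  by (rule gen_ideal_retraction) (auto simp: Q1_subst_base Q1_subst_cong)

lemma prime_Q1_base: "L \<noteq> {} \<Longrightarrow> prime_ideal (gen_ideal (Q1_base d L) :: 'a::field mpoly set)"
  by (metis ex_in_conv prime_retraction Q1_subst_base Q1_subst_cong)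

lemma cprod_nonzero: "cprod L \<noteq> (0 :: 'a::field mpoly)"
  unfolding cprod_def by simp

lemma Q1_subst_cprod: "subst (Q1_subst d L k) (cprod L) = cprod L"
  unfolding cprod_def by (simp add: Q1_subst_def)

lemma cprod_insert: "j \<notin> L \<Longrightarrow> cprod (insert j L) = c1 j * cprod L"
  unfolding cprod_def by simp

lemma Var_dvd_cprod: "i \<in> L \<Longrightarrow> c1 i dvd cprod L"
  unfolding cprod_def by (rule dvd_prodI) auto

lemma gen_ideal_dvd: "f \<in> gen_ideal S \<Longrightarrow> f dvd g \<Longrightarrow> g \<in> gen_ideal S"
  by (auto simp: gen_ideal_closed elim!: dvdE)

lemma gen_ideal_mult_dvd: "f * g \<in> gen_ideal S \<Longrightarrow> g dvd h \<Longrightarrow> f * h \<in> gen_ideal S"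
  by (rule gen_ideal_dvd[OF _ mult_dvd_mono[OF dvd_refl]])

lemma Var_mult_dvd_cprod:
  assumes "i \<in> L" "j \<in> L" "i \<noteq> j"
  shows "c1 i * c1 j dvd cprod L"
proof -
  have "L = insert i (insert j (L - {i, j}))" using assms by auto
  then have "cprod L = c1 i * (c1 j * cprod (L - {i, j}))"
    using cprod_insert[of i "insert j (L - {i, j})"] cprod_insert[of j "L - {i, j}"] assms(3)
    by (metis DiffD2 insertCI insertE)
  then show ?thesis by (metis dvd_triv_left mult.assoc)
qed

text \<open>Multiplying \<open>cprod L\<close> by a new \<open>c1 j\<close> reaches a larger
  support, already in \<open>U\<close>; the relations indexed by L are available because
  \<open>c1 i\<close>, or \<open>c1 i * c1 j\<close> for i \<noteq> j, divides
  \<open>cprod L\<close>. Conversely each monomial from \<open>U\<close> contains some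
  \<open>c1 j\<close> with j \<notin> L, which lies in \<open>Q1_base d L\<close>.\<close>

lemma colon_cprod:
  fixes \<epsilon> :: "'a::field mpoly"
  assumes L: "L \<noteq> {}" "L \<notin> U" and up: "\<And>L'. L \<subset> L' \<Longrightarrow> L' \<in> U"
    and nsub: "\<And>L'. L' \<in> U \<Longrightarrow> \<not> L' \<subseteq> L"
    and nzd: "\<And>p. p * cprod L \<in> gen_ideal (insert \<epsilon> (Q1_base d L)) \<Longrightarrow> p \<in> gen_ideal (insert \<epsilon> (Q1_base d L))"
  shows "{r. r * cprod L \<in> gen_ideal (filt_gens d \<epsilon> U)} = gen_ideal (insert \<epsilon> (Q1_base d L))"
proof (rule colon_eqI[OF _ _ nzd])
  obtain k where k: "k \<in> L" using L by blast
  have sub: "gen_ideal (Q1_base d L) \<subseteq> gen_ideal (insert \<epsilon> (Q1_base d L))"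
    by (rule gen_ideal_mono) (auto intro: gen_ideal_base)
  show "filt_gens d \<epsilon> U \<subseteq> gen_ideal (insert \<epsilon> (Q1_base d L))"
  proof
    fix s assume "s \<in> filt_gens d \<epsilon> U"
    then consider "s \<in> K_base_gens d" | i where "s = \<epsilon> * c1 i" | L' where "L' \<in> U" "s = cprod L'"
      unfolding filt_gens_def by blast
    then show "s \<in> gen_ideal (insert \<epsilon> (Q1_base d L))"
    proof cases
      case 1
      then show ?thesis using sub Q1_subst_K_base gen_ideal_Q1_base[OF k] by blast
    next
      case 2
      then show ?thesis by (simp add: gen_ideal_base gen_ideal_closed)
    next
      case 3
      then obtain j where "j \<in> L'" "j \<notin> L" using nsub by blast
      then show ?thesis unfolding 3
        by (intro gen_ideal_dvd[OF _ Var_dvd_cprod] gen_ideal_base) (auto simp: Q1_base_def)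
    qed
  qed
  let ?I = "gen_ideal (filt_gens d \<epsilon> U)"
  fix q assume "q \<in> insert \<epsilon> (Q1_base d L)"
  then consider "q = \<epsilon>" | j where "j \<notin> L" "q = c1 j" | i where "i \<in> L" "q = b0 I2 - b1 i * b0 I3"
    | i where "i \<in> L" "q = b0 I1 - b1 i ^ d * b0 I4"
    | i j where "i \<in> L" "j \<in> L" "q = b1 i - b1 j"
    unfolding Q1_base_def by blast
  then show "q * cprod L \<in> ?I"
  proof cases
    case 1
    have "\<epsilon> * c1 k \<in> ?I" by (rule gen_ideal_base) (auto simp: filt_gens_def)
    then show ?thesis unfolding 1 by (rule gen_ideal_mult_dvd[OF _ Var_dvd_cprod[OF k]])
  next
    case 2
    then have "insert j L \<in> U" using up by blast
    then show ?thesis unfolding 2 cprod_insert[OF 2(1), symmetric]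
      by (intro gen_ideal_base) (auto simp: filt_gens_def)
  next
    case 3
    have "c1 i * q \<in> ?I" unfolding 3 by (rule gen_ideal_base) (unfold filt_gens_def K_base_gens_def, blast)
    then show ?thesis
      by (intro gen_ideal_mult_dvd[OF _ Var_dvd_cprod[OF 3(1)]]) (simp add: mult.commute)
  next
    case 4
    have "c1 i * q \<in> ?I" unfolding 4 by (rule gen_ideal_base) (unfold filt_gens_def K_base_gens_def, blast)
    then show ?thesis
      by (intro gen_ideal_mult_dvd[OF _ Var_dvd_cprod[OF 4(1)]]) (simp add: mult.commute)
  next
    case 5
    show ?thesis
    proof (cases "i = j")
      case True
      then show ?thesis using 5 by (simp add: gen_ideal_closed)
    next
      case False
      have "c1 i * c1 j * q \<in> ?I" unfolding 5 by (rule gen_ideal_base) (unfold filt_gens_def K_base_gens_def, blast)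
      then show ?thesis
        by (intro gen_ideal_mult_dvd[OF _ Var_mult_dvd_cprod[OF 5(1,2) False]]) (simp add: mult.commute)
    qed
  qed
qed

text \<open>The singleton supports contribute every \<open>c1 i\<close>, and modulo these only the
  first binomial survives.\<close>

lemma gen_ideal_filt_gens_full:
  assumes "\<And>L. L \<in> U \<longleftrightarrow> L \<noteq> {}"
  shows "gen_ideal (filt_gens d \<epsilon> U) = Q2 d"
  unfolding Q2_def
proof (rule gen_ideal_eqI)
  let ?Q = "gen_ideal (C1set \<union> {b0 I1 * b0 I3 ^ d - b0 I4 * b0 I2 ^ d})"
  have c: "c1 i \<in> ?Q" for i
    by (cases i) (auto intro!: gen_ideal_base simp: C1set_def)
  show "filt_gens d \<epsilon> U \<subseteq> ?Q"
  proof
    fix s assume "s \<in> filt_gens d \<epsilon> U"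
    then consider "s = b0 I1 * b0 I3 ^ d - b0 I4 * b0 I2 ^ d" | i t where "s = c1 i * t"
      | i j t where "s = c1 i * c1 j * t" | i where "s = \<epsilon> * c1 i" | L where "s = cprod L" "L \<in> U"
      unfolding filt_gens_def K_base_gens_def by blast
    then show "s \<in> ?Q"
    proof cases
      case 1
      then show ?thesis by (intro gen_ideal_base) simp
    next
      case 5
      then obtain i where "i \<in> L" using assms by blast
      then show ?thesis unfolding 5 by (rule gen_ideal_dvd[OF c Var_dvd_cprod])
    next
      case 2
      show ?thesis unfolding 2 by (rule gen_ideal_closed(4)[OF c])
    next
      case 3
      show ?thesis unfolding 3 by (rule gen_ideal_closed(4)[OF gen_ideal_closed(4)[OF c]])
    next
      case 4
      show ?thesis unfolding 4 by (rule gen_ideal_closed(3)[OF c])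
    qed
  qed
  have "cprod {i} \<in> cprod ` U" for i using assms by auto
  then have "c1 i \<in> gen_ideal (filt_gens d \<epsilon> U)" for i
    by (intro gen_ideal_base) (auto simp: filt_gens_def cprod_def)
  then show "C1set \<union> {b0 I1 * b0 I3 ^ d - b0 I4 * b0 I2 ^ d} \<subseteq> gen_ideal (filt_gens d \<epsilon> U)"
    unfolding C1set_def using gen_ideal_base[of _ "filt_gens d \<epsilon> U"] by (auto simp: filt_gens_def K_base_gens_def)
qed

text \<open>Adjoining the monomials \<open>cprod L\<close> one at a time, larger \<open>L\<close> first, leads from the ideal to
  \<open>Q2 d\<close>, and every step has the colon ideal generated by \<open>insert \<epsilon> (Q1_base d L)\<close>.\<close>

lemma filtration_induct:
  fixes \<epsilon> :: "'a::field mpoly"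
  assumes step: "\<And>S u. T {r. r * u \<in> gen_ideal S} \<Longrightarrow> T (gen_ideal (insert u S)) \<Longrightarrow> T (gen_ideal S)"
    and Q2: "T (Q2 d)"
    and Q1_base: "\<And>L. L \<noteq> {} \<Longrightarrow> T (gen_ideal (insert \<epsilon> (Q1_base d L)))"
    and nzd: "\<And>L p. L \<noteq> {} \<Longrightarrow> p * cprod L \<in> gen_ideal (insert \<epsilon> (Q1_base d L))
        \<Longrightarrow> p \<in> gen_ideal (insert \<epsilon> (Q1_base d L))"
  shows "T (gen_ideal (K_base_gens d \<union> {\<epsilon> * c1 i | i. True}))"
proof -
  \<comment> \<open>Generalised to every upward closed family \<open>U\<close> of nonempty supports,
    by induction on the number of nonempty supports still missing. The property \<open>T\<close> is
    abstract because it is instantiated both by a bound on associated primes and by cancellability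
    of a power of \<open>b0 I4\<close>.\<close>
  have "T (gen_ideal (filt_gens d \<epsilon> U))"
    if "{} \<notin> U" "\<And>L L'. L \<in> U \<Longrightarrow> L \<subseteq> L' \<Longrightarrow> L' \<in> U" for U
    using that
  proof (induction "card (- insert {} U)" arbitrary: U rule: less_induct)
    case less
    show ?case
    proof (cases "- insert {} U = {}")
      case True
      then have "L \<in> U \<longleftrightarrow> L \<noteq> {}" for L using less.prems(1) by blast
      then show ?thesis using gen_ideal_filt_gens_full[of U d \<epsilon>] Q2 by simp
    next
      case False
      \<comment> \<open>A maximal missing support: all its proper supersets are in \<open>U\<close>,
        as \<open>colon_cprod\<close> requires.\<close>
      then obtain L where L: "L \<in> - insert {} U" "\<And>L'. L' \<in> - insert {} U \<Longrightarrow> L \<subseteq> L' \<Longrightarrow> L' = L"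
        using finite_has_maximal[of "- insert {} U"] by auto
      have up: "L' \<in> U" if "L \<subset> L'" for L' using L(2)[of L'] that by auto
      have "T (gen_ideal (filt_gens d \<epsilon> (insert L U)))"
      proof (rule less.hyps)
        have "- insert {} (insert L U) \<subset> - insert {} U" using L(1) by auto
        then show "card (- insert {} (insert L U)) < card (- insert {} U)"
          by (intro psubset_card_mono) auto
        show "{} \<notin> insert L U" using L(1) less.prems(1) by auto
        fix M M' assume "M \<in> insert L U" "M \<subseteq> M'"
        then show "M' \<in> insert L U" using up[of M'] less.prems(2)[of M M'] by auto
      qed
      moreover have "insert (cprod L) (filt_gens d \<epsilon> U) = filt_gens d \<epsilon> (insert L U)"
        by (simp add: filt_gens_def)
      moreover have "{r. r * cprod L \<in> gen_ideal (filt_gens d \<epsilon> U)} = gen_ideal (insert \<epsilon> (Q1_base d L))"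
      proof (rule colon_cprod)
        show "L \<noteq> {}" "L \<notin> U" using L(1) by auto
        then show "\<not> L' \<subseteq> L" if "L' \<in> U" for L' using less.prems(2)[OF that] by blast
      qed (use L(1) in \<open>auto intro: up nzd\<close>)
      ultimately show ?thesis using step[of "cprod L" "filt_gens d \<epsilon> U"] Q1_base[of L] L(1) by simp
    qed
  qed
  from this[of "{}"] show ?thesis by (simp add: filt_gens_def)
qed

section \<open>Primality of \<open>Q2 d\<close> and cancellation of \<open>b0 I4\<close>\<close>

lemma prime_Q2:
  assumes "d \<ge> 1"
  shows "prime_ideal (Q2 d :: 'a::field mpoly set)"
proof -
  \<comment> \<open>The binomial in \<open>Q2 d\<close> is the toric relation for these variables.
    The parameter may be \<open>C1 I1\<close>, since the retraction sends all \<open>c1 i\<close> to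
    0.\<close>
  interpret toric "B0 I1" "B0 I4" "B0 I2" "B0 I3" "C1 I1" d
    using assms by unfold_locales auto
  let ?\<sigma> = "\<lambda>v. case v of C1 i \<Rightarrow> 0 | _ \<Rightarrow> (Var v :: 'a mpoly)"
  have c: "c1 i \<in> gen_ideal C1set" for i
    by (cases i) (auto intro!: gen_ideal_base simp: C1set_def)
  have "prime_ideal (gen_ideal (insert rel C1set) :: 'a mpoly set)"
    by (rule prime_ideal_rel[of _ ?\<sigma>])
       (auto simp: C1set_def free_of_Var gen_ideal_closed split: var.split intro: c[unfolded C1set_def])
  then show ?thesis by (simp add: Q2_def rel_def)
qed

lemma Q2_nonzerodivisor:
  assumes "d \<ge> 1"
  shows "b0 I4 \<notin> (Q2 d :: 'a::field mpoly set)"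
  unfolding Q2_def
  by (rule notin_gen_ideal[of _ "\<lambda>v. case v of B0 I4 \<Rightarrow> b0 I4 | _ \<Rightarrow> 0"])
     (use assms in \<open>auto simp: C1set_def\<close>)

text \<open>With \<epsilon> = 0 the extra generators \<open>0 * c1 i\<close> are trivial, every
  colon ideal of the filtration is the prime \<open>gen_ideal (Q1_base d L)\<close> and the top is
  the prime \<open>Q2 d\<close>. None of these primes contains \<open>b0 I4\<close>, and
  cancellability descends along the filtration.\<close>

lemma K_base_nonzerodivisor:
  assumes "d \<ge> 1"
  shows "b0 I4 ^ n * g \<in> gen_ideal (K_base_gens d :: 'a::field mpoly set) \<Longrightarrow> g \<in> gen_ideal (K_base_gens d)"
proof -
  have prime: "\<forall>g. b0 I4 ^ n * g \<in> P \<longrightarrow> g \<in> P" if "prime_ideal P" "b0 I4 \<notin> P" for P :: "'a mpoly set"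
  proof clarify
    have "b0 I4 ^ n \<notin> P"
    proof (induction n)
      case 0
      show ?case using that is_idealD(3)[of P 1] unfolding prime_ideal_def by (auto intro: ccontr)
    next
      case (Suc n)
      then show ?case using that unfolding prime_ideal_def by auto
    qed
    then show "g \<in> P" if "b0 I4 ^ n * g \<in> P" for g
      using that \<open>prime_ideal P\<close> unfolding prime_ideal_def by blast
  qed
  have 0: "gen_ideal (insert 0 S) = gen_ideal S" for S :: "'a mpoly set"
    by (rule gen_ideal_eqI) (auto simp: gen_ideal_closed intro: gen_ideal_base)
  have prime_L: "prime_ideal (gen_ideal (insert 0 (Q1_base d L)) :: 'a mpoly set)" if "L \<noteq> {}" for L
    using prime_Q1_base[OF that] by (simp add: 0)
  have notin: "b0 I4 \<notin> gen_ideal (insert 0 (Q1_base d L) :: 'a mpoly set)"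
    "cprod L \<notin> gen_ideal (insert 0 (Q1_base d L) :: 'a mpoly set)" if L: "L \<noteq> {}" for L
  proof -
    obtain k where "k \<in> L" using L by blast
    then show "b0 I4 \<notin> gen_ideal (insert 0 (Q1_base d L) :: 'a mpoly set)"
        "cprod L \<notin> gen_ideal (insert 0 (Q1_base d L) :: 'a mpoly set)"
      by (simp_all add: 0 gen_ideal_Q1_base Q1_subst_cprod cprod_nonzero) (simp add: Q1_subst_def)
  qed
  have "\<forall>g. b0 I4 ^ n * g \<in> gen_ideal (K_base_gens d \<union> {0 * c1 i | i. True}) \<longrightarrow>
      g \<in> gen_ideal (K_base_gens d \<union> {0 * c1 i | i. True} :: 'a mpoly set)"
  proof (rule filtration_induct[where T = "\<lambda>I. \<forall>g. b0 I4 ^ n * g \<in> I \<longrightarrow> g \<in> I"])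
    fix S and u :: "'a mpoly"
    assume colon: "\<forall>g. b0 I4 ^ n * g \<in> {r. r * u \<in> gen_ideal S} \<longrightarrow> g \<in> {r. r * u \<in> gen_ideal S}"
      and ins: "\<forall>g. b0 I4 ^ n * g \<in> gen_ideal (insert u S) \<longrightarrow> g \<in> gen_ideal (insert u S)"
    show "\<forall>g. b0 I4 ^ n * g \<in> gen_ideal S \<longrightarrow> g \<in> gen_ideal S"
    \<comment> \<open>Cancel first modulo the larger ideal, so that g = r u modulo
      \<open>gen_ideal S\<close>; then cancel in r u, using the colon ideal by u.\<close>
    proof clarify
      fix g assume g: "b0 I4 ^ n * g \<in> gen_ideal S"
      then have "b0 I4 ^ n * g \<in> gen_ideal (insert u S)"
        unfolding gen_ideal_insert by (intro exI[of _ 0]) simp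
      then obtain r where r: "g - r * u \<in> gen_ideal S" using ins gen_ideal_insert by blast
      have "b0 I4 ^ n * r * u \<in> gen_ideal S"
        by (rule gen_ideal_comb2[OF g r, of _ 1 "- (b0 I4 ^ n)"]) (simp add: algebra_simps)
      then have "r * u \<in> gen_ideal S" using colon by simp
      with r show "g \<in> gen_ideal S" using gen_ideal_closed(2) by fastforce
    qed
  next
    show "\<forall>g. b0 I4 ^ n * g \<in> Q2 d \<longrightarrow> g \<in> (Q2 d :: 'a mpoly set)"
      by (rule prime[OF prime_Q2 Q2_nonzerodivisor]) (use assms in auto)
  next
    fix L :: "idx set" assume L: "L \<noteq> {}"
    show "\<forall>g. b0 I4 ^ n * g \<in> gen_ideal (insert 0 (Q1_base d L)) \<longrightarrow>
        g \<in> (gen_ideal (insert 0 (Q1_base d L)) :: 'a mpoly set)"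
      by (rule prime[OF prime_L[OF L] notin(1)[OF L]])
    show "p \<in> gen_ideal (insert 0 (Q1_base d L))" if "p * cprod L \<in> gen_ideal (insert 0 (Q1_base d L))"
      for p :: "'a mpoly"
      using that prime_L[OF L] notin(2)[OF L] unfolding prime_ideal_def by blast
  qed
  moreover have "gen_ideal (K_base_gens d \<union> {0 * c1 i | i. True}) = gen_ideal (K_base_gens d :: 'a mpoly set)"
    using 0[of "K_base_gens d"] by simp
  ultimately show "b0 I4 ^ n * g \<in> gen_ideal (K_base_gens d :: 'a mpoly set) \<Longrightarrow> g \<in> gen_ideal (K_base_gens d)"
    by simp
qed


section \<open>The primes \<open>Q1 L\<close> as associated primes of the filtration\<close>

lemma gen_ideal_insert_Q1_base:
  assumes "L \<noteq> {}"
  shows "gen_ideal (insert (b0 I4) (Q1_base d L)) = Q1 L"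
  unfolding Q1_def
proof (rule gen_ideal_eqI)
  let ?S = "{b0 I1, b0 I4} \<union> {c1 i | i. i \<notin> L}
          \<union> {b0 I2 - b1 i * b0 I3 | i. i \<in> L} \<union> {b1 i - b1 j | i j. i \<in> L \<and> j \<in> L}"
  have *: "b0 I1 - b1 i ^ d * b0 I4 \<in> gen_ideal ?S" for i
    by (rule gen_ideal_comb2[of "b0 I1" _ "b0 I4" _ 1 "- (b1 i ^ d)"]) (auto intro: gen_ideal_base)
  show "insert (b0 I4) (Q1_base d L) \<subseteq> gen_ideal ?S"
    unfolding Q1_base_def using * gen_ideal_superset[of ?S] by blast
  obtain k where k: "k \<in> L" using assms by blast
  \<comment> \<open>Only a relation indexed by some k \<in> L can produce \<open>b0 I1\<close> from
    \<open>b0 I4\<close>; this is where L must be nonempty.\<close>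
  have "b0 I1 \<in> gen_ideal (insert (b0 I4) (Q1_base d L))"
  proof (rule gen_ideal_comb2)
    show "b0 I1 - b1 k ^ d * b0 I4 \<in> gen_ideal (insert (b0 I4) (Q1_base d L))"
      using k by (intro gen_ideal_base) (unfold Q1_base_def, blast)
    show "b0 I4 \<in> gen_ideal (insert (b0 I4) (Q1_base d L))" by (rule gen_ideal_base) simp
    show "b0 I1 = 1 * (b0 I1 - b1 k ^ d * b0 I4) + b1 k ^ d * b0 I4" by simp
  qed
  then show "?S \<subseteq> gen_ideal (insert (b0 I4) (Q1_base d L))"
    using gen_ideal_superset[of "insert (b0 I4) (Q1_base d L)"] unfolding Q1_base_def by blast
qed


lemma Q1_retraction:
  fixes d :: nat
  assumes "k \<in> L"
  defines "\<sigma> \<equiv> \<lambda>v. if v \<in> {B0 I1, B0 I4} then 0 else Q1_subst d L k v"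
  shows "prime_ideal (Q1 L :: 'a::field mpoly set)" "Q1 L = {p :: 'a mpoly. subst \<sigma> p = 0}"
proof -
  let ?S = "{b0 I1, b0 I4} \<union> {c1 i | i. i \<notin> L}
          \<union> {b0 I2 - b1 i * b0 I3 | i. i \<in> L} \<union> {b1 i - b1 j | i j. i \<in> L \<and> j \<in> L} :: 'a mpoly set"
  have ker: "subst \<sigma> s = 0" if s: "s \<in> ?S" for s
  proof -
    consider "s = b0 I1" | "s = b0 I4" | i where "i \<notin> L" "s = c1 i"
      | i where "i \<in> L" "s = b0 I2 - b1 i * b0 I3" | i j where "i \<in> L" "j \<in> L" "s = b1 i - b1 j"
      using s by blast
    then show ?thesis by cases (simp_all add: \<sigma>_def Q1_subst_def)
  qed
  have cong: "Var v - \<sigma> v \<in> gen_ideal ?S" for v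
  proof (cases "v \<in> {B0 I1, B0 I4}")
    case True
    then have "\<sigma> v = 0" "Var v \<in> {b0 I1, b0 I4 :: 'a mpoly}" by (auto simp: \<sigma>_def)
    moreover from this(2) have "Var v \<in> ?S" by blast
    ultimately show ?thesis using gen_ideal_base[of "Var v" ?S] by (simp only: diff_zero)
  next
    case False
    then have "\<sigma> v = Q1_subst d L k v" by (simp add: \<sigma>_def)
    moreover have "gen_ideal (Q1_base d L) \<subseteq> gen_ideal (insert (b0 I4) (Q1_base d L) :: 'a mpoly set)"
      using gen_ideal_superset[of "insert (b0 I4) (Q1_base d L)"] by (intro gen_ideal_mono) blast
    moreover have "gen_ideal (insert (b0 I4) (Q1_base d L)) = gen_ideal ?S"
      using gen_ideal_insert_Q1_base[of L d] assms(1) unfolding Q1_def by blast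
    ultimately show ?thesis using Q1_subst_cong[OF assms(1), of v d] by (metis subsetD)
  qed
  show "prime_ideal (Q1 L :: 'a mpoly set)"
    unfolding Q1_def by (rule prime_retraction[OF ker cong])
  show "Q1 L = {p :: 'a mpoly. subst \<sigma> p = 0}"
    unfolding Q1_def by (rule gen_ideal_retraction[OF ker cong])
qed

text \<open>With \<epsilon> = \<open>b0 I4 ^ n\<close> each colon ideal is a prime plus a power of
  \<open>b0 I4\<close>, so its only possible associated prime is \<open>Q1 L\<close>. As
  \<open>cprod L\<close> lies outside \<open>Q1 L\<close>, it is a nonzerodivisor there, which
  validates the computation of the colon ideal.\<close>

lemma Ass_quot_filtration:
  assumes "d \<ge> 1"
  shows "Ass_quot (gen_ideal (K_base_gens d \<union> {b0 I4 ^ n * c1 i | i. True}) :: 'a::field mpoly set)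
      \<subseteq> {Q1 L | L. L \<noteq> {}} \<union> {Q2 d}" (is "_ \<subseteq> ?X")
proof (rule filtration_induct[where T = "\<lambda>I. Ass_quot I \<subseteq> ?X"])
  show "Ass_quot (Q2 d) \<subseteq> ?X" using Ass_quot_prime[OF prime_Q2[OF assms]] by blast
next
  fix S and u :: "'a mpoly"
  assume "Ass_quot {r. r * u \<in> gen_ideal S} \<subseteq> ?X" "Ass_quot (gen_ideal (insert u S)) \<subseteq> ?X"
  then show "Ass_quot (gen_ideal S) \<subseteq> ?X" using Ass_quot_gen_insert[of S u] by blast
next
  fix L :: "idx set" assume L: "L \<noteq> {}"
  then obtain k where k: "k \<in> L" by blast
  note eq = gen_ideal_insert_Q1_base[OF L, of d]
  have e: "b0 I4 \<notin> gen_ideal (Q1_base d L :: 'a mpoly set)"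
    by (simp add: gen_ideal_Q1_base[OF k]) (simp add: Q1_subst_def)
  have Q1: "prime_ideal (gen_ideal (insert (b0 I4) (Q1_base d L)) :: 'a mpoly set)"
    unfolding eq by (rule Q1_retraction(1)[OF k])
  have c: "cprod L \<notin> gen_ideal (insert (b0 I4) (Q1_base d L) :: 'a mpoly set)"
    unfolding eq Q1_retraction(2)[OF k, of d] cprod_def by (simp add: Q1_subst_def)
  show "Ass_quot (gen_ideal (insert (b0 I4 ^ n) (Q1_base d L)) :: 'a mpoly set) \<subseteq> ?X"
    using Ass_quot_power[OF prime_Q1_base[OF L] e Q1, of n] L unfolding eq by blast
  show "p \<in> gen_ideal (insert (b0 I4 ^ n) (Q1_base d L))"
    if "p * cprod L \<in> gen_ideal (insert (b0 I4 ^ n) (Q1_base d L))" for p :: "'a mpoly"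
    by (rule nonzerodivisor_power[OF prime_Q1_base[OF L] e Q1 c that])
qed

section \<open>The colon ideal by \<open>b0 I4 ^ d\<close>\<close>

text \<open>The last five elements are the last five generators of \<open>K2 d\<close> divided by
  \<open>b0 I4 ^ d\<close>, after \<open>b0 I1 ^ d * c1 i\<close> has been replaced by
  \<open>b1 i ^ d\<^sup>2 * b0 I4 ^ d * c1 i\<close>.\<close>

definition colon_gens :: "nat \<Rightarrow> 'a::comm_ring_1 mpoly set" where
  "colon_gens d = K_base_gens d \<union> {c1 I1 - b1 I2 ^ d\<^sup>2 * c1 I2, c1 I4 - b1 I3 ^ d\<^sup>2 * c1 I3,
     b1 I2 ^ d\<^sup>2 * c1 I2 - b1 I3 ^ d\<^sup>2 * c1 I3, c1 I2 * b1 I1 - c1 I3 * b1 I4, c1 I2 * (b1 I2 - b1 I3)}"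

lemma K_base_gens_mem:
  assumes "K_base_gens d \<subseteq> S"
  shows "c1 i * (b0 I2 - b1 i * b0 I3) \<in> gen_ideal S" "c1 i * (b0 I1 - b1 i ^ d * b0 I4) \<in> gen_ideal S"
    "c1 i * c1 j * (b1 i - b1 j) \<in> gen_ideal S"
    "c1 i * (b0 I1 ^ d - b1 i ^ d\<^sup>2 * b0 I4 ^ d) \<in> gen_ideal S"
proof -
  show "c1 i * (b0 I2 - b1 i * b0 I3) \<in> gen_ideal S" "c1 i * c1 j * (b1 i - b1 j) \<in> gen_ideal S"
    by (rule gen_ideal_base, rule subsetD[OF assms], subst K_base_gens_def, blast)+
  show *: "c1 i * (b0 I1 - b1 i ^ d * b0 I4) \<in> gen_ideal S"
    by (rule gen_ideal_base, rule subsetD[OF assms], unfold K_base_gens_def, blast)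
  \<comment> \<open>The d-th power version of the preceding relation, valid because that relation
    holds in the colon ideal by \<open>c1 i\<close>.\<close>
  show "c1 i * (b0 I1 ^ d - b1 i ^ d\<^sup>2 * b0 I4 ^ d) \<in> gen_ideal S"
    using gen_ideal_power_diff[OF *, of d]
    by (simp add: power_mult_distrib power_mult[symmetric] power2_eq_square)
qed

definition K_gens :: "nat \<Rightarrow> 'a::comm_ring_1 mpoly set" where
  "K_gens d = K_base_gens d \<union> {b0 I4 ^ d * c1 I1 - b0 I1 ^ d * c1 I2,
      b0 I4 ^ d * c1 I4 - b0 I1 ^ d * c1 I3,
      b0 I1 ^ d * (c1 I2 - c1 I3),
      b0 I4 ^ d * (c1 I2 * b1 I1 - c1 I3 * b1 I4),
      b0 I4 ^ d * c1 I2 * (b1 I2 - b1 I3)}"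

lemma K2_eq_gen_ideal: "K2 d = gen_ideal (K_gens d)"
  unfolding K2_def K_gens_def K_base_gens_def by (simp add: Un_assoc)

lemma colon_gens_mult_mem:
  assumes "g \<in> colon_gens d"
  shows "g * b0 I4 ^ d \<in> gen_ideal (K_gens d)"
proof -
  let ?I = "gen_ideal (K_gens d)"
  have sub: "K_base_gens d \<subseteq> K_gens d" unfolding K_gens_def by blast
  have mem: "b0 I4 ^ d * c1 I1 - b0 I1 ^ d * c1 I2 \<in> ?I" "b0 I4 ^ d * c1 I4 - b0 I1 ^ d * c1 I3 \<in> ?I"
    "b0 I1 ^ d * (c1 I2 - c1 I3) \<in> ?I" "b0 I4 ^ d * (c1 I2 * b1 I1 - c1 I3 * b1 I4) \<in> ?I"
    "b0 I4 ^ d * c1 I2 * (b1 I2 - b1 I3) \<in> ?I"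
    unfolding K_gens_def by (rule gen_ideal_base, blast)+
  note a = K_base_gens_mem(4)[OF sub]
  consider "g \<in> K_base_gens d" | "g = c1 I1 - b1 I2 ^ d\<^sup>2 * c1 I2" | "g = c1 I4 - b1 I3 ^ d\<^sup>2 * c1 I3"
    | "g = b1 I2 ^ d\<^sup>2 * c1 I2 - b1 I3 ^ d\<^sup>2 * c1 I3" | "g = c1 I2 * b1 I1 - c1 I3 * b1 I4"
    | "g = c1 I2 * (b1 I2 - b1 I3)"
    using assms unfolding colon_gens_def by blast
  then show ?thesis
  proof cases
    case 1
    then show ?thesis using sub by (intro gen_ideal_closed(4) gen_ideal_base) blast
  next
    case 2
    show ?thesis unfolding 2
      by (rule gen_ideal_comb2[OF mem(1) a[of I2], of _ 1 1]) (simp add: algebra_simps)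
  next
    case 3
    show ?thesis unfolding 3
      by (rule gen_ideal_comb2[OF mem(2) a[of I3], of _ 1 1]) (simp add: algebra_simps)
  next
    case 4
    show ?thesis unfolding 4
      by (rule gen_ideal_comb3[OF mem(3) a[of I2] a[of I3], of _ 1 "- 1" 1]) (simp add: algebra_simps)
  next
    case 5
    show ?thesis unfolding 5 by (rule gen_ideal_comb1[OF mem(4), of _ 1]) (simp add: algebra_simps)
  next
    case 6
    show ?thesis unfolding 6 by (rule gen_ideal_comb1[OF mem(5), of _ 1]) (simp add: algebra_simps)
  qed
qed

lemma K_gens_decompose:
  assumes "s \<in> K_gens d"
  shows "\<exists>l\<in>gen_ideal (colon_gens d). s - l * b0 I4 ^ d \<in> gen_ideal (K_base_gens d)"
proof -
  let ?B = "gen_ideal (K_base_gens d)"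
  note a = K_base_gens_mem(4)[OF subset_refl, where d = d]
  have mem: "c1 I1 - b1 I2 ^ d\<^sup>2 * c1 I2 \<in> gen_ideal (colon_gens d)"
    "c1 I4 - b1 I3 ^ d\<^sup>2 * c1 I3 \<in> gen_ideal (colon_gens d)"
    "b1 I2 ^ d\<^sup>2 * c1 I2 - b1 I3 ^ d\<^sup>2 * c1 I3 \<in> gen_ideal (colon_gens d)"
    "c1 I2 * b1 I1 - c1 I3 * b1 I4 \<in> gen_ideal (colon_gens d)" "c1 I2 * (b1 I2 - b1 I3) \<in> gen_ideal (colon_gens d)"
    unfolding colon_gens_def by (rule gen_ideal_base, blast)+
  consider "s \<in> K_base_gens d" | "s = b0 I4 ^ d * c1 I1 - b0 I1 ^ d * c1 I2"
    | "s = b0 I4 ^ d * c1 I4 - b0 I1 ^ d * c1 I3" | "s = b0 I1 ^ d * (c1 I2 - c1 I3)"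
    | "s = b0 I4 ^ d * (c1 I2 * b1 I1 - c1 I3 * b1 I4)" | "s = b0 I4 ^ d * c1 I2 * (b1 I2 - b1 I3)"
    using assms unfolding K_gens_def by blast
  then show ?thesis
  proof cases
    case 1
    then show ?thesis by (intro bexI[of _ 0]) (simp_all add: gen_ideal_base gen_ideal_closed)
  next
    case 2
    show ?thesis unfolding 2
      by (rule bexI[OF _ mem(1)], rule gen_ideal_comb1[OF a[of I2], of _ "- 1"]) (simp add: algebra_simps)
  next
    case 3
    show ?thesis unfolding 3
      by (rule bexI[OF _ mem(2)], rule gen_ideal_comb1[OF a[of I3], of _ "- 1"]) (simp add: algebra_simps)
  next
    case 4
    show ?thesis unfolding 4
      by (rule bexI[OF _ mem(3)], rule gen_ideal_comb2[OF a[of I2] a[of I3], of _ 1 "- 1"]) (simp add: algebra_simps)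
  next
    case 5
    show ?thesis unfolding 5
      by (rule bexI[OF _ mem(4)]) (simp add: algebra_simps gen_ideal_closed)
  next
    case 6
    show ?thesis unfolding 6
      by (rule bexI[OF _ mem(5)]) (simp add: algebra_simps gen_ideal_closed)
  qed
qed

text \<open>Every element of \<open>K2 d\<close> is l times \<open>b0 I4 ^ d\<close> modulo the
  first generators, with l in \<open>gen_ideal (colon_gens d)\<close>; this holds for generators by
  \<open>K_gens_decompose\<close> and is stable under ideal operations. If r times
  \<open>b0 I4 ^ d\<close> has this form, cancelling the power shows that r - l lies in
  \<open>gen_ideal (K_base_gens d)\<close>.\<close>

lemma colon_K2:
  assumes "d \<ge> 1"
  shows "{r. r * b0 I4 ^ d \<in> gen_ideal (K_gens d)} = gen_ideal (colon_gens d :: 'a::field mpoly set)"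
proof
  show "gen_ideal (colon_gens d) \<subseteq> {r :: 'a mpoly. r * b0 I4 ^ d \<in> gen_ideal (K_gens d)}"
    by (rule gen_ideal_least[OF is_ideal_colon[OF is_ideal_gen_ideal]]) (use colon_gens_mult_mem in blast)
  let ?J = "{s :: 'a mpoly. \<exists>l\<in>gen_ideal (colon_gens d). s - l * b0 I4 ^ d \<in> gen_ideal (K_base_gens d)}"
  have "is_ideal ?J"
    unfolding is_ideal_def
  proof (intro conjI allI ballI)
    show "0 \<in> ?J"
      by (rule CollectI, rule bexI[of _ 0]) (simp_all add: gen_ideal_closed)
  next
    fix a b assume "a \<in> ?J" "b \<in> ?J"
    then obtain l m where l: "l \<in> gen_ideal (colon_gens d)" "a - l * b0 I4 ^ d \<in> gen_ideal (K_base_gens d)"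
      and m: "m \<in> gen_ideal (colon_gens d)" "b - m * b0 I4 ^ d \<in> gen_ideal (K_base_gens d)" by blast
    have "a + b - (l + m) * b0 I4 ^ d \<in> gen_ideal (K_base_gens d)"
      by (rule gen_ideal_comb2[OF l(2) m(2), of _ 1 1]) (simp add: algebra_simps)
    then show "a + b \<in> ?J" using gen_ideal_closed(2)[OF l(1) m(1)] by blast
  next
    fix r a assume "a \<in> ?J"
    then obtain l where l: "l \<in> gen_ideal (colon_gens d)" "a - l * b0 I4 ^ d \<in> gen_ideal (K_base_gens d)"
      by blast
    have "r * a - r * l * b0 I4 ^ d \<in> gen_ideal (K_base_gens d)"
      by (rule gen_ideal_comb1[OF l(2), of _ r]) (simp add: algebra_simps)
    then show "r * a \<in> ?J" using gen_ideal_closed(3)[OF l(1)] by blast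
  qed
  then have "gen_ideal (K_gens d) \<subseteq> ?J" by (rule gen_ideal_least) (use K_gens_decompose in blast)
  moreover have "gen_ideal (K_base_gens d) \<subseteq> gen_ideal (colon_gens d :: 'a mpoly set)"
    by (rule gen_ideal_mono) (use gen_ideal_superset[of "colon_gens d"] in \<open>unfold colon_gens_def, blast\<close>)
  ultimately show "{r. r * b0 I4 ^ d \<in> gen_ideal (K_gens d)} \<subseteq> gen_ideal (colon_gens d :: 'a mpoly set)"
  proof (intro subsetI, elim CollectE)
    fix r :: "'a mpoly"
    assume sub: "gen_ideal (K_gens d) \<subseteq> ?J" "gen_ideal (K_base_gens d) \<subseteq> gen_ideal (colon_gens d :: 'a mpoly set)"
      and "r * b0 I4 ^ d \<in> gen_ideal (K_gens d)"
    then obtain l where l: "l \<in> gen_ideal (colon_gens d)"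
        "r * b0 I4 ^ d - l * b0 I4 ^ d \<in> gen_ideal (K_base_gens d :: 'a mpoly set)" by blast
    have eq: "r * b0 I4 ^ d - l * b0 I4 ^ d = b0 I4 ^ d * (r - l)" by (simp add: algebra_simps)
    have "r - l \<in> gen_ideal (K_base_gens d)"
      by (rule K_base_nonzerodivisor[OF assms l(2)[unfolded eq]])
    then have "r - l \<in> gen_ideal (colon_gens d)" using sub(2) by blast
    from gen_ideal_closed(2)[OF l(1) this] show "r \<in> gen_ideal (colon_gens d)" by simp
  qed
qed

lemma Ass_quot_K2:
  assumes "d \<ge> 1"
  shows "Ass_quot (K2 d :: 'a::field mpoly set)
      \<subseteq> Ass_quot (gen_ideal (colon_gens d)) \<union> ({Q1 L | L. L \<noteq> {}} \<union> {Q2 d})"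
proof -
  let ?J = "K_base_gens d \<union> {b0 I4 ^ d * c1 i | i. True} :: 'a mpoly set"
  have a: "c1 i * (b0 I1 ^ d - b1 i ^ d\<^sup>2 * b0 I4 ^ d) \<in> gen_ideal ?J" for i
    by (rule K_base_gens_mem(4)) blast
  have e: "b0 I4 ^ d * c1 i \<in> gen_ideal ?J" for i
    by (rule gen_ideal_base) blast
  \<comment> \<open>The last five generators of \<open>K2 d\<close> are combinations of the elements
    \<open>b0 I4 ^ d * c1 i\<close> and \<open>b0 I1 ^ d * c1 i\<close>, so both kinds are needed in
    \<open>?J\<close>.\<close>
  have ac: "b0 I1 ^ d * c1 i \<in> gen_ideal ?J" for i
    by (rule gen_ideal_comb2[OF a[of i] e[of i], of _ 1 "b1 i ^ d\<^sup>2"]) (simp add: algebra_simps)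
  have "K_gens d \<subseteq> gen_ideal ?J"
  proof -
    have "b0 I4 ^ d * c1 I1 - b0 I1 ^ d * c1 I2 \<in> gen_ideal ?J"
      by (rule gen_ideal_closed(6)[OF e ac])
    moreover have "b0 I4 ^ d * c1 I4 - b0 I1 ^ d * c1 I3 \<in> gen_ideal ?J"
      by (rule gen_ideal_closed(6)[OF e ac])
    moreover have "b0 I1 ^ d * (c1 I2 - c1 I3) \<in> gen_ideal ?J"
      using gen_ideal_closed(6)[OF ac ac, of I2 I3] by (simp add: algebra_simps)
    moreover have "b0 I4 ^ d * (c1 I2 * b1 I1 - c1 I3 * b1 I4) \<in> gen_ideal ?J"
      by (rule gen_ideal_comb2[OF e[of I2] e[of I3], of _ "b1 I1" "- b1 I4"]) (simp add: algebra_simps)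
    moreover have "b0 I4 ^ d * c1 I2 * (b1 I2 - b1 I3) \<in> gen_ideal ?J"
      by (rule gen_ideal_closed(4)[OF e])
    ultimately show ?thesis
      unfolding K_gens_def using gen_ideal_superset[of ?J] by blast
  qed
  \<comment> \<open>The set \<open>?J\<close> adjoins only the products
    \<open>b0 I4 ^ d * c1 i\<close>, not \<open>b0 I4 ^ d\<close> itself; it suffices that its ideal
    lies inside the one obtained by adjoining \<open>b0 I4 ^ d\<close> to
    \<open>K2 d\<close>.\<close>
  moreover have "\<exists>w. g - w * b0 I4 ^ d \<in> gen_ideal (K_gens d)" if "g \<in> gen_ideal ?J" for g
  proof -
    have e: "b0 I4 ^ d \<in> gen_ideal (insert (b0 I4 ^ d) (K_gens d))" by (rule gen_ideal_base) simp
    have "K_base_gens d \<subseteq> gen_ideal (insert (b0 I4 ^ d) (K_gens d))"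
      using gen_ideal_superset[of "insert (b0 I4 ^ d) (K_gens d)"] unfolding K_gens_def by blast
    then have "?J \<subseteq> gen_ideal (insert (b0 I4 ^ d) (K_gens d))"
      using gen_ideal_closed(4)[OF e] by blast
    then show ?thesis using gen_ideal_mono that gen_ideal_insert by blast
  qed
  ultimately have "Ass_quot (gen_ideal (K_gens d)) \<subseteq>
      Ass_quot {r. r * b0 I4 ^ d \<in> gen_ideal (K_gens d)} \<union> Ass_quot (gen_ideal ?J)"
    by (intro Ass_quot_insert is_ideal_gen_ideal gen_ideal_mono)
  then show ?thesis using Ass_quot_filtration[OF assms, of d] unfolding K2_eq_gen_ideal colon_K2[OF assms] by blast
qed


section \<open>The embedded primes \<open>Q20\<close> and \<open>Q19\<close>\<close>

lemma alg_closed_split: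
  assumes "alg_closed TYPE('a::field)"
  shows "p \<noteq> 0 \<Longrightarrow> \<exists>as. (p :: 'a poly) = smult (lead_coeff p) (\<Prod>a\<leftarrow>as. [:- a, 1:])"
proof (induction "degree p" arbitrary: p)
  case 0
  then obtain c where "p = [:c:]" by (metis degree_eq_zeroE)
  then show ?case by (intro exI[of _ "[]"]) simp
next
  case (Suc n)
  then obtain a where "poly p a = 0" using assms unfolding alg_closed_def by (metis Suc_le_eq zero_less_Suc One_nat_def)
  then obtain q where q: "p = [:- a, 1:] * q" by (metis dvdE poly_eq_0_iff_dvd)
  then have "q \<noteq> 0" using Suc.prems by auto
  then have "degree p = Suc (degree q)" unfolding q by (subst degree_mult_eq) auto
  then obtain as where "q = smult (lead_coeff q) (\<Prod>a\<leftarrow>as. [:- a, 1:])"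
    using Suc \<open>q \<noteq> 0\<close> by auto
  moreover have "lead_coeff p = lead_coeff q" unfolding q by (simp only: lead_coeff_mult) simp
  ultimately have "p = smult (lead_coeff p) (\<Prod>a\<leftarrow>a # as. [:- a, 1:])"
    using q by (metis (no_types, lifting) list.simps(9) mult_smult_right prod_list.Cons)
  then show ?case by blast
qed

text \<open>The homogenisation w^n p(u/w) of a polynomial p of degree at most n, evaluated at two
  elements of the polynomial ring.\<close>

definition homog :: "nat \<Rightarrow> 'a::comm_ring_1 poly \<Rightarrow> 'a mpoly \<Rightarrow> 'a mpoly \<Rightarrow> 'a mpoly" where
  "homog n p u w = (\<Sum>j\<le>n. Const (coeff p j) * u ^ j * w ^ (n - j))"

lemma Const_diff: "Const (a - b) = Const a - Const b"
  by (simp add: Const_def single_diff)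

text \<open>Expand (x - a) p as x p - a p. The first sum has zero constant coefficient and shifts to
  u times the form; the second has zero top coefficient by the degree bound and leaves a factor
  w.\<close>

lemma homog_linear_mult:
  assumes "degree p \<le> n"
  shows "homog (Suc n) ([:- a, 1:] * p) u w = (u - Const a * w) * homog n p u w"
proof -
  have "homog (Suc n) ([:- a, 1:] * p) u w
      = (\<Sum>j\<le>Suc n. Const (coeff (pCons 0 p) j) * u ^ j * w ^ (Suc n - j))
        - Const a * (\<Sum>j\<le>Suc n. Const (coeff p j) * u ^ j * w ^ (Suc n - j))"
    unfolding homog_def sum_distrib_left sum_subtractf[symmetric]
    by (rule sum.cong) (simp_all add: Const_diff Const_mult left_diff_distrib mult.assoc)
  also have "(\<Sum>j\<le>Suc n. Const (coeff (pCons 0 p) j) * u ^ j * w ^ (Suc n - j)) = u * homog n p u w"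
    unfolding sum.atMost_Suc_shift homog_def sum_distrib_left by (simp add: algebra_simps)
  also have "(\<Sum>j\<le>Suc n. Const (coeff p j) * u ^ j * w ^ (Suc n - j)) = w * homog n p u w"
  proof -
    have "coeff p (Suc n) = 0" using assms by (simp add: coeff_eq_0)
    then have "(\<Sum>j\<le>Suc n. Const (coeff p j) * u ^ j * w ^ (Suc n - j))
        = (\<Sum>j\<le>n. Const (coeff p j) * u ^ j * w ^ (Suc n - j))" by simp
    also have "\<dots> = w * homog n p u w"
      unfolding homog_def sum_distrib_left
      by (rule sum.cong) (simp_all add: Suc_diff_le mult_ac)
    finally show ?thesis .
  qed
  finally show ?thesis by (simp add: algebra_simps)
qed

text \<open>The degree is carried through the same induction because
  \<open>homog_linear_mult\<close> needs it.\<close>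

lemma homog_prod:
  "homog (length as) (\<Prod>a\<leftarrow>as. [:- a, 1:]) u w = (\<Prod>a\<leftarrow>as. u - Const a * (w :: 'a::field mpoly))
   \<and> degree (\<Prod>a\<leftarrow>as. [:- a, 1 :: 'a:]) = length as"
proof (induction as)
  case Nil
  show ?case by (simp add: homog_def)
next
  case (Cons a as)
  have "(\<Prod>a\<leftarrow>as. [:- a, 1:]) \<noteq> 0" by (auto simp: prod_list_zero_iff)
  then have "degree ([:- a, 1:] * (\<Prod>a\<leftarrow>as. [:- a, 1:])) = Suc (length as)"
    using Cons by (subst degree_mult_eq) auto
  then show ?case using Cons homog_linear_mult[of "\<Prod>a\<leftarrow>as. [:- a, 1:]" "length as" a u w]
    by (simp only: list.map prod_list.Cons list.size) simp
qed

text \<open>The left-hand sum homogenises 1 + x + ... + x^(d-1), which is monic of degree d - 1. Its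
  roots satisfy a^d = 1, since x - 1 times this polynomial is x^d - 1.\<close>

lemma geometric_factorization:
  assumes ac: "alg_closed TYPE('a::field)" and d: "d \<ge> 1"
  shows "\<exists>as. (\<forall>a\<in>set as. a ^ d = 1) \<and>
    (\<Sum>i<d. w ^ (d - Suc i) * u ^ i) = (\<Prod>a\<leftarrow>as. u - Const a * (w :: 'a mpoly))"
proof -
  define p :: "'a poly" where "p = (\<Sum>i<d. monom 1 i)"
  have coeff: "coeff p j = (if j < d then 1 else 0)" for j
    by (simp add: p_def coeff_sum)
  have deg: "degree p = d - 1"
    by (rule antisym[OF degree_le le_degree]) (use d in \<open>auto simp: coeff\<close>)
  have "lead_coeff p = 1" using d by (simp add: deg coeff)
  moreover from this have "p \<noteq> 0" by auto
  ultimately obtain as where as: "p = (\<Prod>a\<leftarrow>as. [:- a, 1:])"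
    using alg_closed_split[OF ac, of p] by auto
  have "a ^ d = 1" if "a \<in> set as" for a
  proof -
    have "poly p a = 0" unfolding as using that by (induction as) auto
    moreover have "poly p a = (\<Sum>i<d. a ^ i)" by (simp add: p_def poly_sum poly_monom)
    ultimately have "a ^ d - 1 = 0" using power_diff_1_eq[of a d] by simp
    then show ?thesis by simp
  qed
  moreover have "length as = d - 1" using homog_prod[of as] as deg by metis
  then have "(\<Prod>a\<leftarrow>as. u - Const a * w) = homog (d - 1) p u w"
    using homog_prod[of as u w] as by metis
  moreover have "homog (d - 1) p u w = (\<Sum>i<d. w ^ (d - Suc i) * u ^ i)"
    unfolding homog_def by (rule sum.cong) (use d in \<open>auto simp: coeff mult.commute\<close>)
  ultimately show ?thesis by (intro exI[of _ as]) simp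
qed

section \<open>The element \<open>emb_elt d\<close> and its colon ideal\<close>

definition emb_elt :: "nat \<Rightarrow> 'a::comm_ring_1 mpoly" where
  "emb_elt d = b1 I2 ^ d\<^sup>2 * c1 I2 * (b1 I1 - b1 I2)"

text \<open>The part common to \<open>Q20\<close> and all \<open>Q19 d \<alpha>\<close>: each of
  these arises by adjoining one linear element.\<close>

definition emb_base :: "nat \<Rightarrow> 'a::comm_ring_1 mpoly set" where
  "emb_base d = C1set \<union> {b1 I1 - b1 I4, b1 I2 - b1 I3, b0 I2, b0 I3, b0 I1 - b1 I2 ^ d * b0 I4}"

definition geom_sum :: "nat \<Rightarrow> 'a::comm_ring_1 mpoly" where
  "geom_sum d = (\<Sum>i<d. b1 I1 ^ (d - Suc i) * b1 I2 ^ i)"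

lemma geom_sum_mult: "(b1 I2 - b1 I1) * geom_sum d = b1 I2 ^ d - b1 I1 ^ d"
  unfolding geom_sum_def by (rule power_diff_sumr2[symmetric])

section \<open>Relations in an arbitrary ideal containing \<open>colon_gens d\<close>\<close>

context
  fixes d :: nat and S :: "'a::field mpoly set"
  assumes G: "colon_gens d \<subseteq> S"
begin

lemma colon_gens_mem:
  shows "c1 i * (b0 I2 - b1 i * b0 I3) \<in> gen_ideal S" "c1 i * (b0 I1 - b1 i ^ d * b0 I4) \<in> gen_ideal S"
    "c1 i * c1 j * (b1 i - b1 j) \<in> gen_ideal S"
    "c1 I1 - b1 I2 ^ d\<^sup>2 * c1 I2 \<in> gen_ideal S" "c1 I4 - b1 I3 ^ d\<^sup>2 * c1 I3 \<in> gen_ideal S"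
    "b1 I2 ^ d\<^sup>2 * c1 I2 - b1 I3 ^ d\<^sup>2 * c1 I3 \<in> gen_ideal S"
    "c1 I2 * b1 I1 - c1 I3 * b1 I4 \<in> gen_ideal S" "c1 I2 * (b1 I2 - b1 I3) \<in> gen_ideal S"
    "c1 I2 * (b1 I2 ^ d\<^sup>2 - b1 I3 ^ d\<^sup>2) \<in> gen_ideal S"
proof -
  have "K_base_gens d \<subseteq> S" using G unfolding colon_gens_def by blast
  note K = K_base_gens_mem[OF this]
  show "c1 i * (b0 I2 - b1 i * b0 I3) \<in> gen_ideal S" "c1 i * (b0 I1 - b1 i ^ d * b0 I4) \<in> gen_ideal S"
    "c1 i * c1 j * (b1 i - b1 j) \<in> gen_ideal S" by (rule K)+
  show "c1 I1 - b1 I2 ^ d\<^sup>2 * c1 I2 \<in> gen_ideal S" "c1 I4 - b1 I3 ^ d\<^sup>2 * c1 I3 \<in> gen_ideal S"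
    "b1 I2 ^ d\<^sup>2 * c1 I2 - b1 I3 ^ d\<^sup>2 * c1 I3 \<in> gen_ideal S"
    "c1 I2 * b1 I1 - c1 I3 * b1 I4 \<in> gen_ideal S"
    by (rule gen_ideal_base, rule subsetD[OF G], subst colon_gens_def, blast)+
  show *: "c1 I2 * (b1 I2 - b1 I3) \<in> gen_ideal S"
    by (rule gen_ideal_base, rule subsetD[OF G], subst colon_gens_def, blast)
  show "c1 I2 * (b1 I2 ^ d\<^sup>2 - b1 I3 ^ d\<^sup>2) \<in> gen_ideal S" by (rule gen_ideal_power_diff[OF *])
qed

lemma colon_gens_diff14: "b1 I2 ^ d\<^sup>2 * c1 I2 * (b1 I1 - b1 I4) \<in> gen_ideal S"
  by (rule gen_ideal_comb3[OF colon_gens_mem(7) colon_gens_mem(9) colon_gens_mem(6), of _ "b1 I3 ^ d\<^sup>2" "b1 I1" "- b1 I4"])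
     (simp add: algebra_simps)

text \<open>Modulo \<open>gen_ideal S\<close> the factor \<open>b1 I2 ^ d\<^sup>2 * c1 I2\<close>
  equals \<open>c1 I1\<close>, so \<open>emb_elt d\<close> becomes
  \<open>c1 I1 * (b1 I1 - b1 I2)\<close>, which the relation for the pair I1, I2 kills after
  multiplication by \<open>c1 I2\<close>.\<close>

lemma emb_elt_c2: "c1 I2 * emb_elt d \<in> gen_ideal S"
  unfolding emb_elt_def
  by (rule gen_ideal_comb2[OF colon_gens_mem(3)[of I1 I2] colon_gens_mem(4), of _ 1 "- (c1 I2 * (b1 I1 - b1 I2))"])
     (simp add: algebra_simps)

text \<open>As for \<open>c1 I2\<close>, but \<open>b1 I2\<close> is first exchanged for
  \<open>b1 I3\<close>, which the factor \<open>c1 I2\<close> permits, so that the relation for the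
  pair I1, I3 applies.\<close>

lemma emb_elt_c3: "c1 I3 * emb_elt d \<in> gen_ideal S"
  unfolding emb_elt_def
  by (rule gen_ideal_comb3[OF colon_gens_mem(3)[of I1 I3] colon_gens_mem(4) colon_gens_mem(8), of _ 1 "- (c1 I3 * (b1 I1 - b1 I3))"
        "- (b1 I2 ^ d\<^sup>2 * c1 I3)"])
     (simp add: algebra_simps)

lemma emb_elt_c: "c1 i * emb_elt d \<in> gen_ideal S"
proof (cases i)
  case I1
  show ?thesis unfolding I1
    by (rule gen_ideal_comb2[OF emb_elt_c2 colon_gens_mem(4), of _ "b1 I2 ^ d\<^sup>2" "emb_elt d"]) (simp add: algebra_simps)
next
  case I4
  show ?thesis unfolding I4
    by (rule gen_ideal_comb2[OF emb_elt_c3 colon_gens_mem(5), of _ "b1 I3 ^ d\<^sup>2" "emb_elt d"]) (simp add: algebra_simps)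
qed (simp_all add: emb_elt_c2 emb_elt_c3)

text \<open>The element \<open>b1 I2 ^ d\<^sup>2 * c1 I2\<close>, congruent to \<open>c1 I1\<close>,
  annihilates both \<open>b0 I2 - b1 I1 * b0 I3\<close> and \<open>b0 I2 - b1 I2 * b0 I3\<close>;
  subtract.\<close>

lemma emb_elt_b03: "b0 I3 * emb_elt d \<in> gen_ideal S"
  unfolding emb_elt_def
  by (rule gen_ideal_comb3[OF colon_gens_mem(1)[of I1] colon_gens_mem(4) colon_gens_mem(1)[of I2], of _ "- 1" "b0 I2 - b1 I1 * b0 I3"
        "b1 I2 ^ d\<^sup>2"])
     (simp add: algebra_simps)

lemma emb_base_mult_emb_elt:
  assumes "q \<in> insert (geom_sum d * b0 I4) (emb_base d)"
  shows "q * emb_elt d \<in> gen_ideal S"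
proof -
  consider i where "q = c1 i" | "q = b1 I1 - b1 I4" | "q = b1 I2 - b1 I3" | "q = b0 I2" | "q = b0 I3"
    | "q = b0 I1 - b1 I2 ^ d * b0 I4" | "q = geom_sum d * b0 I4"
    using assms unfolding emb_base_def C1set_def by blast
  then show ?thesis
  proof cases
    case 1
    show ?thesis unfolding 1 by (rule emb_elt_c)
  next
    case 2
    show ?thesis unfolding 2 emb_elt_def
      by (rule gen_ideal_comb1[OF colon_gens_diff14, of _ "b1 I1 - b1 I2"]) (simp add: algebra_simps)
  next
    case 3
    show ?thesis unfolding 3 emb_elt_def
      by (rule gen_ideal_comb1[OF colon_gens_mem(8), of _ "b1 I2 ^ d\<^sup>2 * (b1 I1 - b1 I2)"]) (simp add: algebra_simps)
  next
    case 4
    show ?thesis unfolding 4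
      by (rule gen_ideal_comb2[OF colon_gens_mem(1)[of I2] emb_elt_b03, of _ "b1 I2 ^ d\<^sup>2 * (b1 I1 - b1 I2)" "b1 I2"])
         (simp add: emb_elt_def algebra_simps)
  next
    case 5
    show ?thesis unfolding 5 by (rule emb_elt_b03)
  next
    case 6
    show ?thesis unfolding 6 emb_elt_def
      by (rule gen_ideal_comb1[OF colon_gens_mem(2)[of I2], of _ "b1 I2 ^ d\<^sup>2 * (b1 I1 - b1 I2)"]) (simp add: algebra_simps)
  next
    case 7
    \<comment> \<open>The factor \<open>b1 I1 - b1 I2\<close> of \<open>emb_elt d\<close> completes
      \<open>geom_sum d\<close> to a difference of d-th powers. Times \<open>b0 I4\<close>, this is
      the difference of \<open>b0 I1 - b1 I1 ^ d * b0 I4\<close> and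
      \<open>b0 I1 - b1 I2 ^ d * b0 I4\<close>, both annihilated by
      \<open>b1 I2 ^ d\<^sup>2 * c1 I2\<close>.\<close>
    have "q * emb_elt d = - (b1 I2 ^ d\<^sup>2 * c1 I2 * b0 I4 * ((b1 I2 - b1 I1) * geom_sum d))"
      unfolding 7 emb_elt_def by (simp add: algebra_simps)
    then have eq: "q * emb_elt d = - (b1 I2 ^ d\<^sup>2 * c1 I2 * b0 I4 * (b1 I2 ^ d - b1 I1 ^ d))"
      unfolding geom_sum_mult .
    show ?thesis unfolding eq
      by (rule gen_ideal_comb3[OF colon_gens_mem(2)[of I1] colon_gens_mem(4) colon_gens_mem(2)[of I2], of _ "- 1"
            "b0 I1 - b1 I1 ^ d * b0 I4" "b1 I2 ^ d\<^sup>2"])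
         (simp add: algebra_simps)
  qed
qed

text \<open>Once \<open>emb_elt d\<close> is in the ideal, \<open>b1 I2 ^ d\<^sup>2 * c1 I2\<close>
  identifies \<open>b1 I1\<close> with \<open>b1 I2\<close>; the identifications of
  \<open>b1 I3\<close>, \<open>b1 I4\<close> and of the \<open>c1 i\<close> follow from the
  relations in \<open>colon_gens d\<close>.\<close>

lemma Q17_mult_mem:
  assumes v: "emb_elt d \<in> gen_ideal S"
    and "q \<in> {b1 I2 - b1 i | i. True}
     \<union> {c1 I3 - c1 I2, c1 I1 - b1 I2 ^ (d^2) * c1 I2, c1 I4 - c1 I1,
        b0 I2 - b1 I2 * b0 I3, b0 I1 - b1 I2 ^ d * b0 I4}"
  shows "q * (b1 I2 ^ d\<^sup>2 * c1 I2) \<in> gen_ideal S"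
proof -
  consider i where "q = b1 I2 - b1 i" | "q = c1 I3 - c1 I2" | "q = c1 I1 - b1 I2 ^ (d^2) * c1 I2"
    | "q = c1 I4 - c1 I1" | "q = b0 I2 - b1 I2 * b0 I3" | "q = b0 I1 - b1 I2 ^ d * b0 I4"
    using assms(2) by blast
  then show ?thesis
  proof cases
    case 1
    show ?thesis
    proof (cases i)
      case I1
      show ?thesis unfolding 1 I1 by (rule gen_ideal_comb1[OF v, of _ "- 1"]) (simp add: emb_elt_def algebra_simps)
    next
      case I2
      show ?thesis unfolding 1 I2 by (simp add: gen_ideal_closed)
    next
      case I3
      show ?thesis unfolding 1 I3
        by (rule gen_ideal_comb1[OF colon_gens_mem(8), of _ "b1 I2 ^ d\<^sup>2"]) (simp add: algebra_simps)
    next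
      case I4
      show ?thesis unfolding 1 I4
        by (rule gen_ideal_comb2[OF colon_gens_diff14 v, of _ 1 "- 1"]) (simp add: emb_elt_def algebra_simps)
    qed
  next
    case 2
    show ?thesis unfolding 2
      by (rule gen_ideal_comb2[OF colon_gens_mem(6) colon_gens_mem(9), of _ "- c1 I2" "c1 I3"]) (simp add: algebra_simps)
  next
    case 3
    show ?thesis unfolding 3 by (rule gen_ideal_closed(4)[OF colon_gens_mem(4)])
  next
    case 4
    have "c1 I4 - c1 I1 \<in> gen_ideal S"
      by (rule gen_ideal_comb3[OF colon_gens_mem(5) colon_gens_mem(4) colon_gens_mem(6), of _ 1 "- 1" "- 1"]) (simp add: algebra_simps)
    then show ?thesis unfolding 4 by (rule gen_ideal_closed(4))
  next
    case 5
    show ?thesis unfolding 5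
      by (rule gen_ideal_comb1[OF colon_gens_mem(1)[of I2], of _ "b1 I2 ^ d\<^sup>2"]) (simp add: algebra_simps)
  next
    case 6
    show ?thesis unfolding 6
      by (rule gen_ideal_comb1[OF colon_gens_mem(2)[of I2], of _ "b1 I2 ^ d\<^sup>2"]) (simp add: algebra_simps)
  qed
qed

end


lemma colon_gens_cases:
  assumes "s \<in> colon_gens d"
  obtains "s = b0 I1 * b0 I3 ^ d - b0 I4 * b0 I2 ^ d"
    | i where "s = c1 i * (b0 I2 - b1 i * b0 I3)"
    | i where "s = c1 i * (b0 I1 - b1 i ^ d * b0 I4)"
    | i j where "s = c1 i * c1 j * (b1 i - b1 j)"
    | "s = c1 I1 - b1 I2 ^ d\<^sup>2 * c1 I2" | "s = c1 I4 - b1 I3 ^ d\<^sup>2 * c1 I3"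
    | "s = b1 I2 ^ d\<^sup>2 * c1 I2 - b1 I3 ^ d\<^sup>2 * c1 I3" | "s = c1 I2 * b1 I1 - c1 I3 * b1 I4"
    | "s = c1 I2 * (b1 I2 - b1 I3)"
  using assms unfolding colon_gens_def K_base_gens_def by blast

lemma emb_base_mem:
  assumes "emb_base d \<subseteq> S"
  shows "c1 i \<in> gen_ideal S" "b1 I3 - b1 I2 \<in> gen_ideal S" "b1 I4 - b1 I1 \<in> gen_ideal S"
    "b0 I2 \<in> gen_ideal S" "b0 I3 \<in> gen_ideal S" "b0 I1 - b1 I2 ^ d * b0 I4 \<in> gen_ideal S"
proof -
  have *: "b1 I2 - b1 I3 \<in> gen_ideal S" "b1 I1 - b1 I4 \<in> gen_ideal S"
    by (rule gen_ideal_base, rule subsetD[OF assms], subst emb_base_def, blast)+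
  show "b1 I3 - b1 I2 \<in> gen_ideal S" "b1 I4 - b1 I1 \<in> gen_ideal S"
    using gen_ideal_closed(5)[OF *(1)] gen_ideal_closed(5)[OF *(2)] by simp_all
  show "c1 i \<in> gen_ideal S"
    by (cases i; rule gen_ideal_base, rule subsetD[OF assms], simp add: emb_base_def C1set_def)
  show "b0 I2 \<in> gen_ideal S" "b0 I3 \<in> gen_ideal S" "b0 I1 - b1 I2 ^ d * b0 I4 \<in> gen_ideal S"
    by (rule gen_ideal_base, rule subsetD[OF assms], subst emb_base_def, blast)+
qed

definition emb_subst :: "nat \<Rightarrow> var \<Rightarrow> 'a::comm_ring_1 mpoly" where
  "emb_subst d v = (case v of C1 i \<Rightarrow> 0 | B1 I3 \<Rightarrow> b1 I2 | B1 I4 \<Rightarrow> b1 I1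
     | B0 I1 \<Rightarrow> b1 I2 ^ d * b0 I4 | B0 I2 \<Rightarrow> 0 | B0 I3 \<Rightarrow> 0 | _ \<Rightarrow> Var v)"

lemma emb_subst_cong: "Var v - emb_subst d v \<in> gen_ideal (emb_base d)"
  using emb_base_mem[where d = d, OF subset_refl]
  by (auto simp: emb_subst_def gen_ideal_closed split: var.split idx.split)

lemma emb_base_cases:
  assumes "s \<in> emb_base d"
  obtains i where "s = c1 i" | "s = b1 I1 - b1 I4" | "s = b1 I2 - b1 I3" | "s = b0 I2" | "s = b0 I3"
    | "s = b0 I1 - b1 I2 ^ d * b0 I4"
  using assms unfolding emb_base_def C1set_def by blast

lemma emb_subst_base: "s \<in> emb_base d \<Longrightarrow> subst (emb_subst d) s = 0"
  by (erule emb_base_cases) (simp_all add: emb_subst_def)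

lemma prime_emb_base: "prime_ideal (gen_ideal (emb_base d) :: 'a::field mpoly set)"
  by (rule prime_retraction[of _ "emb_subst d"]) (simp_all add: emb_subst_base emb_subst_cong)

lemma gen_ideal_emb_base: "gen_ideal (emb_base d) = {p. subst (emb_subst d) p = 0}"
  by (rule gen_ideal_retraction) (simp_all add: emb_subst_base emb_subst_cong)

text \<open>Every element of \<open>colon_gens d\<close> is mapped to a multiple of
  \<open>c1 I2 * b1 I2 ^ d\<^sup>2 * (b1 I2 - b1 I1)\<close>, the negative of the image of \<open>emb_elt d\<close>; so this factor
  can be cancelled from a relation \<open>r * emb_elt d \<in> gen_ideal (colon_gens d)\<close>.\<close>

definition detect :: "nat \<Rightarrow> var \<Rightarrow> 'a::comm_ring_1 mpoly" where
  "detect d v = (case v of C1 I2 \<Rightarrow> c1 I2 | C1 I3 \<Rightarrow> c1 I2 | C1 _ \<Rightarrow> b1 I2 ^ d\<^sup>2 * c1 I2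
     | B1 I3 \<Rightarrow> b1 I2 | B1 I4 \<Rightarrow> b1 I1
     | B0 I1 \<Rightarrow> b1 I2 ^ d * b0 I4 | B0 I2 \<Rightarrow> 0 | B0 I3 \<Rightarrow> 0 | _ \<Rightarrow> Var v)"

lemma detect_cong: "Var v - detect d v \<in> gen_ideal (emb_base d)"
  using emb_base_mem[where d = d, OF subset_refl]
  by (auto simp: detect_def gen_ideal_closed split: var.split idx.split
      intro: gen_ideal_closed(6) gen_ideal_closed(3))

text \<open>Only two kinds of generators can survive:
  \<open>c1 i * (b0 I1 - b1 i ^ d * b0 I4)\<close> with i in {I1, I4}, which gives the multiple of
  \<open>geom_sum d * b0 I4\<close>, and the pair relations with one index in {I1, I4} and the other
  in {I2, I3}, which give multiples of \<open>c1 I2\<close>.\<close>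

lemma detect_colon_gens:
  assumes "d \<ge> 1" "s \<in> colon_gens d"
  shows "\<exists>p q. subst (detect d) s
      = c1 I2 * b1 I2 ^ d\<^sup>2 * (b1 I2 - b1 I1) * (p * c1 I2 + q * (geom_sum d * b0 I4))"
  using assms(2)
proof (cases rule: colon_gens_cases)
  case (3 i)
  have "b1 I2 ^ d\<^sup>2 * c1 I2 * (b1 I2 ^ d * b0 I4 - b1 I1 ^ d * b0 I4)
      = c1 I2 * b1 I2 ^ d\<^sup>2 * (b1 I2 - b1 I1) * (0 * c1 I2 + 1 * (geom_sum d * b0 I4) :: 'a mpoly)"
    unfolding left_diff_distrib[symmetric] geom_sum_mult[symmetric] by (simp add: mult_ac)
  then show ?thesis unfolding 3
    by (intro exI[of _ 0] exI[of _ "if i \<in> {I1, I4} then 1 else 0"], cases i) (simp_all add: detect_def)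
next
  case (4 i j)
  show ?thesis unfolding 4
    by (rule exI[of _ "if i \<in> {I1, I4} then if j \<in> {I1, I4} then 0 else - 1
          else if j \<in> {I1, I4} then 1 else 0"], rule exI[of _ 0], cases i; cases j)
       (simp_all add: detect_def algebra_simps)
qed (use assms(1) in \<open>auto simp: detect_def power_0_left intro!: exI[of _ 0]\<close>)

text \<open>For the nontrivial inclusion, cancelling the common factor \<open>?w\<close> leaves
  subst (detect d) r as a combination of \<open>c1 I2\<close> and \<open>geom_sum d * b0 I4\<close>.
  Both lie in the target ideal, and \<open>detect d\<close> changes nothing modulo
  \<open>emb_base d\<close>, so r lies there too.\<close>

lemma colon_emb_elt:
  assumes "d \<ge> 1"
  shows "{r. r * emb_elt d \<in> gen_ideal (colon_gens d)} = (gen_ideal (insert (geom_sum d * b0 I4) (emb_base d)) :: 'a::field mpoly set)"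
proof
  show "gen_ideal (insert (geom_sum d * b0 I4) (emb_base d)) \<subseteq> {r :: 'a mpoly. r * emb_elt d \<in> gen_ideal (colon_gens d)}"
    by (rule gen_ideal_least[OF is_ideal_colon[OF is_ideal_gen_ideal]])
       (use emb_base_mult_emb_elt[OF subset_refl] in blast)
  let ?w = "c1 I2 * b1 I2 ^ d\<^sup>2 * (b1 I2 - b1 I1) :: 'a mpoly"
  let ?Z = "{s :: 'a mpoly. \<exists>p q. subst (detect d) s = ?w * (p * c1 I2 + q * (geom_sum d * b0 I4))}"
  have "is_ideal ?Z"
    unfolding is_ideal_def
  proof (intro conjI allI ballI)
    have "subst (detect d) 0 = ?w * (0 * c1 I2 + 0 * (geom_sum d * b0 I4))" by simp
    then show "0 \<in> ?Z" by blast
  next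
    fix a b assume "a \<in> ?Z" "b \<in> ?Z"
    then obtain p q p' q' where "subst (detect d) a = ?w * (p * c1 I2 + q * (geom_sum d * b0 I4))"
      "subst (detect d) b = ?w * (p' * c1 I2 + q' * (geom_sum d * b0 I4))" by blast
    then have "subst (detect d) (a + b) = ?w * ((p + p') * c1 I2 + (q + q') * (geom_sum d * b0 I4))"
      by (simp only: subst_add) (simp only: distrib_left distrib_right add_ac)
    then show "a + b \<in> ?Z" by blast
  next
    fix r a assume "a \<in> ?Z"
    then obtain p q where "subst (detect d) a = ?w * (p * c1 I2 + q * (geom_sum d * b0 I4))" by blast
    then have "subst (detect d) (r * a)
        = ?w * (subst (detect d) r * p * c1 I2 + subst (detect d) r * q * (geom_sum d * b0 I4))"
      by (simp only: subst_mult) (simp only: distrib_left distrib_right mult_ac)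
    then show "r * a \<in> ?Z" by blast
  qed
  then have Z: "gen_ideal (colon_gens d) \<subseteq> ?Z"
    by (rule gen_ideal_least) (use detect_colon_gens[OF assms] in blast)
  show "{r. r * emb_elt d \<in> gen_ideal (colon_gens d)} \<subseteq> (gen_ideal (insert (geom_sum d * b0 I4) (emb_base d)) :: 'a mpoly set)"
  proof (intro subsetI, elim CollectE)
    fix r :: "'a mpoly"
    assume "r * emb_elt d \<in> gen_ideal (colon_gens d)"
    with Z obtain p q where "subst (detect d) (r * emb_elt d) = ?w * (p * c1 I2 + q * (geom_sum d * b0 I4))"
      by blast
    moreover have "subst (detect d) (r * emb_elt d) = ?w * (- subst (detect d) r)"
      by (simp add: emb_elt_def detect_def algebra_simps)
    moreover have "?w \<noteq> 0"
    proof -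
      have "b1 I2 - b1 I1 \<noteq> (0 :: 'a mpoly)"
      proof
        assume "b1 I2 - b1 I1 = (0 :: 'a mpoly)"
        then have "subst (\<lambda>v. if v = B1 I1 then 0 else Var v) (b1 I2 - b1 I1 :: 'a mpoly)
            = subst (\<lambda>v. if v = B1 I1 then 0 else Var v) 0" by (rule arg_cong)
        then show False by simp
      qed
      then show ?thesis by simp
    qed
    ultimately have eq: "subst (detect d) r = - (p * c1 I2 + q * (geom_sum d * b0 I4))"
      by (metis mult_left_cancel minus_minus)
    have "geom_sum d * b0 I4 \<in> gen_ideal (insert (geom_sum d * b0 I4) (emb_base d) :: 'a mpoly set)"
      by (rule gen_ideal_base) simp
    moreover have "c1 I2 \<in> gen_ideal (insert (geom_sum d * b0 I4) (emb_base d) :: 'a mpoly set)"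
      by (rule emb_base_mem) blast
    ultimately have "subst (detect d) r \<in> gen_ideal (insert (geom_sum d * b0 I4) (emb_base d))"
      unfolding eq by (rule gen_ideal_comb2[of "geom_sum d * b0 I4" _ "c1 I2" _ "- q" "- p"]) simp
    moreover have "gen_ideal (emb_base d) \<subseteq> gen_ideal (insert (geom_sum d * b0 I4) (emb_base d) :: 'a mpoly set)"
      by (rule gen_ideal_mono) (use gen_ideal_superset in blast)
    then have "r - subst (detect d) r \<in> gen_ideal (insert (geom_sum d * b0 I4) (emb_base d))"
      using subst_cong_ideal[OF is_ideal_gen_ideal detect_cong[of _ d], of r] by blast
    ultimately show "r \<in> gen_ideal (insert (geom_sum d * b0 I4) (emb_base d))"
      using gen_ideal_cong by blast
  qed
qed

section \<open>Primality of \<open>Q20\<close> and \<open>Q19 d \<alpha>\<close>, and their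
  contribution\<close>

lemma gen_ideal_insert_b04: "gen_ideal (insert (b0 I4) (emb_base d)) = Q20"
  unfolding Q20_def
proof (rule gen_ideal_eqI)
  let ?S = "C1set \<union> {b1 I1 - b1 I4, b1 I2 - b1 I3, b0 I1, b0 I2, b0 I3, b0 I4} :: 'a mpoly set"
  have "b0 I1 - b1 I2 ^ d * b0 I4 \<in> gen_ideal ?S"
    by (rule gen_ideal_comb2[of "b0 I1" _ "b0 I4" _ 1 "- (b1 I2 ^ d)"]) (auto intro: gen_ideal_base)
  then show "insert (b0 I4) (emb_base d) \<subseteq> gen_ideal ?S"
    unfolding emb_base_def using gen_ideal_superset[of ?S] by blast
  have e: "b0 I4 \<in> gen_ideal (insert (b0 I4) (emb_base d) :: 'a mpoly set)" by (rule gen_ideal_base) simp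
  have "b0 I1 - b1 I2 ^ d * b0 I4 \<in> gen_ideal (insert (b0 I4) (emb_base d) :: 'a mpoly set)"
    by (rule emb_base_mem) blast
  then have "b0 I1 \<in> gen_ideal (insert (b0 I4) (emb_base d) :: 'a mpoly set)"
    by (rule gen_ideal_comb2[OF _ e, of _ _ 1 "b1 I2 ^ d"]) simp
  then show "?S \<subseteq> gen_ideal (insert (b0 I4) (emb_base d))"
    using gen_ideal_superset[of "insert (b0 I4) (emb_base d)"] unfolding emb_base_def by blast
qed

lemma prime_Q20: "prime_ideal (Q20 :: 'a::field mpoly set)"
proof -
  let ?S = "C1set \<union> {b1 I1 - b1 I4, b1 I2 - b1 I3, b0 I1, b0 I2, b0 I3, b0 I4} :: 'a mpoly set"
  \<comment> \<open>The exponent in \<open>emb_subst\<close> affects only the value at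
    \<open>B0 I1\<close>, which is overridden here, so 0 serves as exponent.\<close>
  let ?\<sigma> = "\<lambda>v. case v of B0 i \<Rightarrow> 0 | _ \<Rightarrow> emb_subst 0 v"
  have b: "b0 i \<in> gen_ideal ?S" for i by (cases i; rule gen_ideal_base, simp)
  have eq: "gen_ideal (insert (b0 I4) (emb_base 0)) = gen_ideal ?S"
    using gen_ideal_insert_b04[of 0] unfolding Q20_def .
  have sub: "gen_ideal (emb_base 0) \<subseteq> gen_ideal ?S"
    unfolding eq[symmetric] using gen_ideal_superset by (intro gen_ideal_mono) blast
  have "prime_ideal (gen_ideal ?S)"
  proof (rule prime_retraction[of _ ?\<sigma>])
    show "subst ?\<sigma> s = 0" if "s \<in> ?S" for s
    proof -
      consider i where "s = b0 i" | i where "s = c1 i" | "s = b1 I1 - b1 I4" | "s = b1 I2 - b1 I3"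
        using \<open>s \<in> ?S\<close> unfolding C1set_def by blast
      then show ?thesis by cases (simp_all add: emb_subst_def)
    qed
    show "Var v - ?\<sigma> v \<in> gen_ideal ?S" for v
      using b subsetD[OF sub emb_subst_cong[of v 0]] by (cases v) (simp_all only: var.case diff_zero)
  qed
  then show ?thesis unfolding Q20_def .
qed

lemma gen_ideal_insert_root:
  "gen_ideal (insert (b1 I2 - Const \<alpha> * b1 I1) (emb_base d)) = Q19 d \<alpha>"
  unfolding Q19_def emb_base_def by (rule arg_cong[of _ _ gen_ideal]) blast

lemma prime_Q19: "prime_ideal (Q19 d \<alpha> :: 'a::field mpoly set)"
proof -
  let ?B = "insert (b1 I2 - Const \<alpha> * b1 I1) (emb_base d) :: 'a mpoly set"
  \<comment> \<open>This is \<open>emb_subst d\<close> followed by \<open>b1 I2\<close> \<mapsto>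
    \<open>Const \<alpha> * b1 I1\<close>: the three listed values are those in which
    \<open>b1 I2\<close> occurs.\<close>
  define \<sigma> :: "var \<Rightarrow> 'a mpoly" where "\<sigma> v = (case v of B1 I2 \<Rightarrow> Const \<alpha> * b1 I1 | B1 I3 \<Rightarrow> Const \<alpha> * b1 I1
     | B0 I1 \<Rightarrow> (Const \<alpha> * b1 I1) ^ d * b0 I4 | _ \<Rightarrow> emb_subst d v)" for v
  have r: "b1 I2 - Const \<alpha> * b1 I1 \<in> gen_ideal ?B" by (rule gen_ideal_base) simp
  have sub: "emb_base d \<subseteq> ?B" by blast
  note B = emb_base_mem[OF sub]
  have b3: "b1 I3 - Const \<alpha> * b1 I1 \<in> gen_ideal ?B"
    by (rule gen_ideal_comb2[OF B(2) r, of _ 1 1]) simp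
  have "b1 I2 ^ d - (Const \<alpha> * b1 I1) ^ d \<in> gen_ideal ?B"
    by (rule power_diff_mem[OF is_ideal_gen_ideal r])
  then have a: "b0 I1 - (Const \<alpha> * b1 I1) ^ d * b0 I4 \<in> gen_ideal ?B"
    by (rule gen_ideal_comb2[OF B(6), of _ _ 1 "b0 I4"]) (simp add: algebra_simps)
  have "gen_ideal (emb_base d) \<subseteq> gen_ideal ?B"
    by (rule gen_ideal_mono) (use gen_ideal_superset[of ?B] in blast)
  then have cong: "Var v - \<sigma> v \<in> gen_ideal ?B" for v
    using subsetD[OF _ emb_subst_cong[of v d]] r b3 a unfolding \<sigma>_def
    by (auto split: var.split idx.split)
  have "prime_ideal (gen_ideal ?B)"
  proof (rule prime_retraction[OF _ cong])
    show "subst \<sigma> s = 0" if "s \<in> ?B" for s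
    proof -
      from that have "s = b1 I2 - Const \<alpha> * b1 I1 \<or> s \<in> emb_base d" by blast
      then show ?thesis
      proof
        assume "s \<in> emb_base d"
        then show ?thesis by (rule emb_base_cases) (simp_all add: \<sigma>_def emb_subst_def)
      qed (simp add: \<sigma>_def emb_subst_def)
    qed
  qed
  then show ?thesis unfolding gen_ideal_insert_root .
qed

text \<open>The colon ideal is the prime of \<open>emb_base d\<close> plus a product of linear
  factors: \<open>b0 I4\<close>, giving \<open>Q20\<close>, and one
  \<open>b1 I2 - Const a * b1 I1\<close> for each root listed, giving
  \<open>Q19 d a\<close>.\<close>

lemma Ass_quot_colon_emb_elt:
  assumes "alg_closed TYPE('a::field)" "d \<ge> 1"
  shows "Ass_quot {r. r * emb_elt d \<in> gen_ideal (colon_gens d :: 'a mpoly set)} \<subseteq> {Q20} \<union> {Q19 d \<alpha> | \<alpha>. \<alpha> ^ d = 1}"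
proof -
  obtain as where as: "\<forall>a\<in>set as. a ^ d = 1" "geom_sum d = (\<Prod>a\<leftarrow>as. b1 I2 - Const a * (b1 I1 :: 'a mpoly))"
    using geometric_factorization[OF assms, of "b1 I1" "b1 I2"] unfolding geom_sum_def by blast
  let ?ts = "b0 I4 # map (\<lambda>a. b1 I2 - Const a * b1 I1) as :: 'a mpoly list"
  have eq: "geom_sum d * b0 I4 = prod_list ?ts" using as(2) by (simp add: mult.commute)
  have notin: "t \<notin> gen_ideal (emb_base d)" if "t \<in> set ?ts" for t
  proof -
    have "b1 I2 - Const a * b1 I1 \<notin> gen_ideal (emb_base d :: 'a mpoly set)" for a
    proof (rule notin_gen_ideal)
      \<comment> \<open>Only the common value of \<open>b1 I2\<close> and \<open>b1 I3\<close> is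
        kept. With \<open>b1 I1\<close> sent to 0 the linear factor becomes \<open>b1 I2\<close>,
        nonzero for every a.\<close>
      show "subst (\<lambda>v. case v of B1 I2 \<Rightarrow> b1 I2 | B1 I3 \<Rightarrow> b1 I2 | _ \<Rightarrow> 0) s = 0" if "s \<in> emb_base d" for s
        using that assms(2) by (cases rule: emb_base_cases) simp_all
    qed simp
    moreover have "b0 I4 \<notin> gen_ideal (emb_base d :: 'a mpoly set)"
      unfolding gen_ideal_emb_base by (simp add: emb_subst_def)
    ultimately show ?thesis using that by auto
  qed
  have "Ass_quot (gen_ideal (insert (prod_list ?ts) (emb_base d)))
      \<subseteq> (\<Union>t\<in>set ?ts. Ass_quot (gen_ideal (insert t (emb_base d))))"
    by (rule Ass_quot_prod_list[OF prime_emb_base notin])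
  also have "\<dots> \<subseteq> {Q20} \<union> {Q19 d \<alpha> | \<alpha>. \<alpha> ^ d = 1}"
  proof (rule UN_least)
    fix t assume "t \<in> set ?ts"
    then consider "t = b0 I4" | a where "a \<in> set as" "t = b1 I2 - Const a * b1 I1" by auto
    then show "Ass_quot (gen_ideal (insert t (emb_base d))) \<subseteq> {Q20} \<union> {Q19 d \<alpha> | \<alpha>. \<alpha> ^ d = 1}"
    proof cases
      case 1
      show ?thesis unfolding 1 gen_ideal_insert_b04 using Ass_quot_prime[OF prime_Q20] by blast
    next
      case 2
      show ?thesis unfolding 2 gen_ideal_insert_root
        using Ass_quot_prime[OF prime_Q19[of d a]] as(1) 2(1) by blast
    qed
  qed
  finally show ?thesis unfolding colon_emb_elt[OF assms(2)] eq .
qed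


section \<open>The primes \<open>Q17_2\<close>, \<open>Q5\<close> and \<open>Q3\<close>\<close>

definition Q17_gens :: "nat \<Rightarrow> 'a::comm_ring_1 mpoly set" where
  "Q17_gens d = {b1 I2 - b1 i | i. True}
     \<union> {c1 I3 - c1 I2, c1 I1 - b1 I2 ^ (d^2) * c1 I2, c1 I4 - c1 I1,
        b0 I2 - b1 I2 * b0 I3, b0 I1 - b1 I2 ^ d * b0 I4}"

definition Q17_subst :: "nat \<Rightarrow> var \<Rightarrow> 'a::comm_ring_1 mpoly" where
  "Q17_subst d v = (case v of B1 i \<Rightarrow> b1 I2 | C1 I2 \<Rightarrow> c1 I2 | C1 I3 \<Rightarrow> c1 I2 | C1 _ \<Rightarrow> b1 I2 ^ d\<^sup>2 * c1 I2
     | B0 I1 \<Rightarrow> b1 I2 ^ d * b0 I4 | B0 I2 \<Rightarrow> b1 I2 * b0 I3 | _ \<Rightarrow> Var v)"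

lemma Q17_retraction:
  shows "prime_ideal (Q17_2 d :: 'a::field mpoly set)" "Q17_2 d = {p :: 'a mpoly. subst (Q17_subst d) p = 0}"
proof -
  have ker: "subst (Q17_subst d) s = 0" if s: "s \<in> Q17_gens d" for s :: "'a mpoly"
  proof -
    consider i where "s = b1 I2 - b1 i" | "s = c1 I3 - c1 I2" | "s = c1 I1 - b1 I2 ^ (d^2) * c1 I2"
      | "s = c1 I4 - c1 I1" | "s = b0 I2 - b1 I2 * b0 I3" | "s = b0 I1 - b1 I2 ^ d * b0 I4"
      using s unfolding Q17_gens_def by blast
    then show ?thesis by cases (simp_all add: Q17_subst_def)
  qed
  let ?I = "gen_ideal (Q17_gens d) :: 'a mpoly set"
  have *: "b1 I2 - b1 i \<in> ?I" "c1 I3 - c1 I2 \<in> ?I" "c1 I1 - b1 I2 ^ d\<^sup>2 * c1 I2 \<in> ?I"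
    "c1 I4 - c1 I1 \<in> ?I" "b0 I2 - b1 I2 * b0 I3 \<in> ?I" "b0 I1 - b1 I2 ^ d * b0 I4 \<in> ?I" for i
    unfolding Q17_gens_def by (rule gen_ideal_base, blast)+
  have 1: "b1 i - b1 I2 \<in> ?I" for i using gen_ideal_closed(5)[OF *(1)[of i]] by simp
  have 4: "c1 I4 - b1 I2 ^ d\<^sup>2 * c1 I2 \<in> ?I" using gen_ideal_closed(2)[OF *(3,4)] by simp
  have cong: "Var v - Q17_subst d v \<in> ?I" for v
    using 1 4 *(2,3,5,6) by (auto simp: Q17_subst_def gen_ideal_closed split: var.split idx.split)
  have eq: "Q17_2 d = ?I" unfolding Q17_2_def Q17_gens_def ..
  show "prime_ideal (Q17_2 d :: 'a mpoly set)"
    unfolding eq by (rule prime_retraction[OF ker cong])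
  show "Q17_2 d = {p :: 'a mpoly. subst (Q17_subst d) p = 0}"
    unfolding eq by (rule gen_ideal_retraction[OF ker cong])
qed

text \<open>The element \<open>b1 I2 ^ d\<^sup>2 * c1 I2\<close> is fixed by the retraction with
  kernel \<open>Q17_2 d\<close>, hence nonzero there and cancellable; the rest is a check on
  generators.\<close>

lemma colon_Q17:
  assumes "d \<ge> 1"
  shows "{r. r * (b1 I2 ^ d\<^sup>2 * c1 I2) \<in> gen_ideal (insert (emb_elt d) (colon_gens d))} = (Q17_2 d :: 'a::field mpoly set)"
proof -
  have Q17: "Q17_2 d = gen_ideal (Q17_gens d)" unfolding Q17_2_def Q17_gens_def ..
  show ?thesis unfolding Q17
  proof (rule colon_eqI, unfold Q17[symmetric])
    have "subst (Q17_subst d) s = 0" if "s \<in> colon_gens d" for s :: "'a mpoly"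
      using that
    proof (cases rule: colon_gens_cases)
      case 1
      then show ?thesis by (simp add: Q17_subst_def power_mult_distrib mult_ac)
    next
      case (2 i)
      then show ?thesis by (simp add: Q17_subst_def)
    next
      case (3 i)
      then show ?thesis by (simp add: Q17_subst_def)
    next
      case (4 i j)
      then show ?thesis by (simp add: Q17_subst_def)
    qed (simp_all add: Q17_subst_def)
    moreover have "subst (Q17_subst d) (emb_elt d) = 0" by (simp add: emb_elt_def Q17_subst_def)
    ultimately show "insert (emb_elt d) (colon_gens d) \<subseteq> (Q17_2 d :: 'a mpoly set)"
      unfolding Q17_retraction(2) by blast
  next
    fix q :: "'a mpoly" assume "q \<in> Q17_gens d"
    then show "q * (b1 I2 ^ d\<^sup>2 * c1 I2) \<in> gen_ideal (insert (emb_elt d) (colon_gens d))"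
      unfolding Q17_gens_def by (intro Q17_mult_mem) (blast intro: gen_ideal_base)+
  next
    fix p :: "'a mpoly" assume "p * (b1 I2 ^ d\<^sup>2 * c1 I2) \<in> Q17_2 d"
    then show "p \<in> Q17_2 d" unfolding Q17_retraction(2) by (simp add: Q17_subst_def)
  qed
qed

section \<open>The prime \<open>Q5\<close> and the colon ideal by \<open>c1 I2\<close>\<close>

definition Q5_linear :: "nat \<Rightarrow> 'a::comm_ring_1 mpoly set" where
  "Q5_linear d = {c1 I1, c1 I4, b1 I2 - b1 I3, b0 I2 - b1 I2 * b0 I3, b0 I1 - b1 I2 ^ d * b0 I4}"

text \<open>A prime that becomes \<open>Q5\<close> when \<open>b1 I2\<close> is adjoined. The
  relations in \<open>Q5_linear d\<close> come from a retraction; the binomial is written in the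
  factor order of \<open>segre.rel\<close>.\<close>

definition Q5_base :: "nat \<Rightarrow> 'a::comm_ring_1 mpoly set" where
  "Q5_base d = insert (b1 I1 * c1 I2 - b1 I4 * c1 I3) (Q5_linear d)"

definition Q5_subst :: "nat \<Rightarrow> var \<Rightarrow> 'a::comm_ring_1 mpoly" where
  "Q5_subst d v = (case v of C1 I1 \<Rightarrow> 0 | C1 I4 \<Rightarrow> 0 | B1 I3 \<Rightarrow> b1 I2
     | B0 I1 \<Rightarrow> b1 I2 ^ d * b0 I4 | B0 I2 \<Rightarrow> b1 I2 * b0 I3 | _ \<Rightarrow> Var v)"

lemma Q5_linear_cases:
  assumes "s \<in> Q5_linear d"
  obtains "s = c1 I1" | "s = c1 I4" | "s = b1 I2 - b1 I3" | "s = b0 I2 - b1 I2 * b0 I3"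
    | "s = b0 I1 - b1 I2 ^ d * b0 I4"
  using assms unfolding Q5_linear_def by blast

lemma Q5_subst_linear: "s \<in> Q5_linear d \<Longrightarrow> subst (Q5_subst d) s = 0"
  by (erule Q5_linear_cases) (simp_all add: Q5_subst_def)

lemma Q5_linear_mem:
  assumes "Q5_linear d \<subseteq> S"
  shows "c1 I1 \<in> gen_ideal S" "c1 I4 \<in> gen_ideal S" "b1 I2 - b1 I3 \<in> gen_ideal S"
    "b1 I3 - b1 I2 \<in> gen_ideal S" "b0 I2 - b1 I2 * b0 I3 \<in> gen_ideal S" "b0 I1 - b1 I2 ^ d * b0 I4 \<in> gen_ideal S"
proof -
  show "c1 I1 \<in> gen_ideal S" "c1 I4 \<in> gen_ideal S"
    "b0 I2 - b1 I2 * b0 I3 \<in> gen_ideal S" "b0 I1 - b1 I2 ^ d * b0 I4 \<in> gen_ideal S"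
    by (rule gen_ideal_base, rule subsetD[OF assms], subst Q5_linear_def, blast)+
  show *: "b1 I2 - b1 I3 \<in> gen_ideal S"
    by (rule gen_ideal_base, rule subsetD[OF assms], subst Q5_linear_def, blast)
  show "b1 I3 - b1 I2 \<in> gen_ideal S" using gen_ideal_closed(5)[OF *] by simp
qed

lemma Q5_subst_cong:
  assumes "Q5_linear d \<subseteq> S"
  shows "Var v - Q5_subst d v \<in> gen_ideal S"
  using Q5_linear_mem[OF assms]
  by (auto simp: Q5_subst_def gen_ideal_closed split: var.split idx.split)

text \<open>The quadric of 2 by 2 matrices with zero determinant is the toric case n = 1. The
  parameter \<open>C1 I1\<close> is free, since the retractions used for \<open>Q5_base d\<close>
  and \<open>Q5\<close> send it to 0.\<close>

interpretation segre: toric "B1 I1" "B1 I4" "C1 I3" "C1 I2" "C1 I1" 1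
  by unfold_locales auto

lemma segre_rel: "segre.rel = b1 I1 * c1 I2 - b1 I4 * c1 I3"
  unfolding segre.rel_def by simp

lemma prime_Q5_base: "prime_ideal (gen_ideal (Q5_base d) :: 'a::field mpoly set)"
  unfolding Q5_base_def segre_rel[symmetric]
proof (rule segre.prime_ideal_rel)
  show "subst (Q5_subst d) s = 0" if "s \<in> Q5_linear d" for s :: "'a mpoly" by (rule Q5_subst_linear[OF that])
  show "Var v - Q5_subst d v \<in> gen_ideal (Q5_linear d :: 'a mpoly set)" for v by (rule Q5_subst_cong[OF subset_refl])
  show "free_of (C1 I1) (Q5_subst d v :: 'a mpoly)" for v
    by (auto simp: Q5_subst_def free_of_Var free_of_mult free_of_power split: var.split idx.split)
qed (simp_all add: Q5_subst_def)

definition Q5_gens :: "'a::comm_ring_1 mpoly set" where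
  "Q5_gens = {c1 I1, c1 I4, b0 I1, b0 I2, b1 I2, b1 I3, c1 I2 * b1 I1 - c1 I3 * b1 I4}"

lemma Q5_eq_gen_ideal: "Q5 = gen_ideal Q5_gens"
  unfolding Q5_def Q5_gens_def ..

lemma Q5_mem:
  "c1 I1 \<in> Q5" "c1 I4 \<in> Q5" "b0 I1 \<in> Q5" "b0 I2 \<in> Q5" "b1 I2 \<in> Q5" "b1 I3 \<in> Q5"
  "b1 I1 * c1 I2 - b1 I4 * c1 I3 \<in> Q5"
proof -
  show "c1 I1 \<in> Q5" "c1 I4 \<in> Q5" "b0 I1 \<in> Q5" "b0 I2 \<in> Q5" "b1 I2 \<in> Q5" "b1 I3 \<in> Q5"
    unfolding Q5_def by (rule gen_ideal_base, blast)+
  have "c1 I2 * b1 I1 - c1 I3 * b1 I4 \<in> Q5"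
    unfolding Q5_def by (rule gen_ideal_base, blast)
  then show "b1 I1 * c1 I2 - b1 I4 * c1 I3 \<in> Q5" by (simp only: mult.commute)
qed

lemma gen_ideal_power:
  assumes "p \<in> gen_ideal S" "n \<ge> 1"
  shows "p ^ n \<in> gen_ideal S"
  using gen_ideal_closed(3)[OF assms(1), of "p ^ (n - 1)"] power_minus_mult[of n p] assms(2) by simp

lemma gen_ideal_insert_Q5_base:
  assumes "d \<ge> 1"
  shows "gen_ideal (insert (b1 I2) (Q5_base d)) = (Q5 :: 'a::field mpoly set)"
proof -
  note closed = gen_ideal_closed[where S = Q5_gens, folded Q5_eq_gen_ideal]
  let ?I = "gen_ideal (insert (b1 I2) (Q5_base d)) :: 'a mpoly set"
  have "b1 I2 ^ d \<in> Q5"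
    unfolding Q5_eq_gen_ideal by (rule gen_ideal_power[OF _ assms]) (simp add: Q5_eq_gen_ideal[symmetric] Q5_mem)
  then have "b0 I1 - b1 I2 ^ d * b0 I4 \<in> Q5" by (rule closed(6)[OF Q5_mem(3) closed(4)])
  moreover have "b0 I2 - b1 I2 * b0 I3 \<in> Q5" by (rule closed(6)[OF Q5_mem(4) closed(4)[OF Q5_mem(5)]])
  moreover have "b1 I2 - b1 I3 \<in> Q5" by (rule closed(6)[OF Q5_mem(5,6)])
  ultimately have "insert (b1 I2) (Q5_base d) \<subseteq> Q5"
    unfolding Q5_base_def Q5_linear_def using Q5_mem by blast
  then have "?I \<subseteq> Q5" unfolding Q5_eq_gen_ideal by (rule gen_ideal_mono)
  moreover have "Q5_gens \<subseteq> ?I"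
  proof -
    have "Q5_linear d \<subseteq> insert (b1 I2) (Q5_base d)" unfolding Q5_base_def by blast
    note S = Q5_linear_mem[OF this]
    have b2: "b1 I2 \<in> ?I" by (rule gen_ideal_base) simp
    have b3: "b1 I3 \<in> ?I" by (rule gen_ideal_comb2[OF S(4) b2, of _ 1 1]) simp
    have x: "b0 I2 \<in> ?I" by (rule gen_ideal_comb2[OF S(5) b2, of _ 1 "b0 I3"]) simp
    have a: "b0 I1 \<in> ?I"
      by (rule gen_ideal_comb2[OF S(6) gen_ideal_power[OF b2 assms], of _ 1 "b0 I4"]) simp
    have "b1 I1 * c1 I2 - b1 I4 * c1 I3 \<in> ?I" by (rule gen_ideal_base) (simp add: Q5_base_def)
    then have "c1 I2 * b1 I1 - c1 I3 * b1 I4 \<in> ?I" by (simp only: mult.commute)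
    then show ?thesis unfolding Q5_gens_def using b2 b3 x a S(1,2) by blast
  qed
  ultimately show ?thesis unfolding Q5_eq_gen_ideal using gen_ideal_mono by blast
qed

lemma prime_Q5: "prime_ideal (Q5 :: 'a::field mpoly set)"
proof -
  let ?S = "{c1 I1, c1 I4, b0 I1, b0 I2, b1 I2, b1 I3} :: 'a mpoly set"
  define \<sigma> :: "var \<Rightarrow> 'a mpoly"
    where "\<sigma> v = (if v \<in> {C1 I1, C1 I4, B0 I1, B0 I2, B1 I2, B1 I3} then 0 else Var v)" for v
  have "prime_ideal (gen_ideal (insert segre.rel ?S) :: 'a mpoly set)"
  proof (rule segre.prime_ideal_rel)
    show "subst \<sigma> s = 0" if "s \<in> ?S" for s using that by (auto simp: \<sigma>_def)
    show "Var v - \<sigma> v \<in> gen_ideal ?S" for v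
      by (cases "v \<in> {C1 I1, C1 I4, B0 I1, B0 I2, B1 I2, B1 I3}")
         (auto simp: \<sigma>_def gen_ideal_closed intro: gen_ideal_base)
    show "free_of (C1 I1) (\<sigma> v)" for v by (simp add: \<sigma>_def free_of_Var)
  qed (simp_all add: \<sigma>_def)
  also have "insert segre.rel ?S = Q5_gens"
    unfolding segre_rel Q5_gens_def by (simp only: mult.commute) blast
  finally show ?thesis unfolding Q5_eq_gen_ideal .
qed

lemma b12_notin_Q5_base: "b1 I2 \<notin> gen_ideal (Q5_base d :: 'a::field mpoly set)"
proof (rule notin_gen_ideal)
  show "subst (\<lambda>v. case v of C1 i \<Rightarrow> 0 | _ \<Rightarrow> Q5_subst d v) s = 0" if "s \<in> Q5_base d" for s :: "'a mpoly"
    using that unfolding Q5_base_def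
  proof (elim insertE)
    assume "s \<in> Q5_linear d"
    then show ?thesis by (rule Q5_linear_cases) (simp_all add: Q5_subst_def)
  qed simp
qed (simp add: Q5_subst_def)

lemma c12_notin_Q5: "c1 I2 \<notin> (Q5 :: 'a::field mpoly set)"
  unfolding Q5_def
  by (rule notin_gen_ideal[of _ "\<lambda>v. if v = C1 I2 then c1 I2 else 0"]) auto

definition colon_gens2 :: "nat \<Rightarrow> 'a::comm_ring_1 mpoly set" where
  "colon_gens2 d = insert (b1 I2 ^ d\<^sup>2 * c1 I2) (insert (emb_elt d) (colon_gens d))"

lemma colon_gens2_subset:
  assumes "colon_gens d \<subseteq> I" "emb_elt d \<in> I" "b1 I2 ^ d\<^sup>2 * c1 I2 \<in> I"
  shows "colon_gens2 d \<subseteq> I"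
  using assms unfolding colon_gens2_def by blast

lemma colon_gens2_mem: "colon_gens d \<subseteq> colon_gens2 d" "b1 I2 ^ d\<^sup>2 * c1 I2 \<in> gen_ideal (colon_gens2 d)"
  unfolding colon_gens2_def by (blast intro: gen_ideal_base)+

text \<open>Multiplication by \<open>c1 I2\<close> turns each generator on the right into a
  consequence of \<open>colon_gens2 d\<close>; and \<open>c1 I2\<close> \<notin> \<open>Q5\<close>,
  so \<open>nonzerodivisor_power\<close> makes it cancellable modulo the prime
  \<open>gen_ideal (Q5_base d)\<close> plus a power of \<open>b1 I2\<close>.\<close>

lemma colon_Q5:
  assumes "d \<ge> 1"
  shows "{r. r * c1 I2 \<in> gen_ideal (colon_gens2 d)} = (gen_ideal (insert (b1 I2 ^ d\<^sup>2) (Q5_base d)) :: 'a::field mpoly set)"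
proof (rule colon_eqI)
  let ?J = "gen_ideal (insert (b1 I2 ^ d\<^sup>2) (Q5_base d)) :: 'a mpoly set"
  have t: "b1 I2 ^ d\<^sup>2 \<in> ?J" by (rule gen_ideal_base) simp
  have rel: "b1 I1 * c1 I2 - b1 I4 * c1 I3 \<in> ?J" by (rule gen_ideal_base) (simp add: Q5_base_def)
  have sub: "Q5_linear d \<subseteq> insert (b1 I2 ^ d\<^sup>2) (Q5_base d)" unfolding Q5_base_def by blast
  \<comment> \<open>Each variable is congruent to its image modulo \<open>?J\<close>, so membership
    can be tested after the retraction, where most generators vanish.\<close>
  have J: "s \<in> ?J" if "subst (Q5_subst d) s \<in> ?J" for s
    using that gen_ideal_cong[OF subst_cong_ideal[OF is_ideal_gen_ideal Q5_subst_cong[OF sub]]] by blast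
  show "colon_gens2 d \<subseteq> ?J"
  proof (rule colon_gens2_subset)
    show "colon_gens d \<subseteq> ?J"
    proof
      fix s :: "'a mpoly" assume "s \<in> colon_gens d"
      then show "s \<in> ?J"
      proof (cases rule: colon_gens_cases)
        case 1
        show ?thesis by (rule J) (simp add: 1 Q5_subst_def power_mult_distrib mult_ac gen_ideal_closed)
      next
        case (2 i)
        show ?thesis by (rule J, cases i) (simp_all add: 2 Q5_subst_def gen_ideal_closed)
      next
        case (3 i)
        show ?thesis by (rule J, cases i) (simp_all add: 3 Q5_subst_def gen_ideal_closed)
      next
        case (4 i j)
        show ?thesis by (rule J, cases i; cases j) (simp_all add: 4 Q5_subst_def gen_ideal_closed)
      next
        case 5
        show ?thesis by (rule J, rule gen_ideal_comb1[OF t, of _ "- c1 I2"]) (simp add: 5 Q5_subst_def)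
      next
        case 6
        show ?thesis by (rule J, rule gen_ideal_comb1[OF t, of _ "- c1 I3"]) (simp add: 6 Q5_subst_def)
      next
        case 7
        show ?thesis by (rule J, rule gen_ideal_comb1[OF t, of _ "c1 I2 - c1 I3"]) (simp add: 7 Q5_subst_def algebra_simps)
      next
        case 8
        show ?thesis by (rule J, rule gen_ideal_comb1[OF rel, of _ 1]) (simp add: 8 Q5_subst_def algebra_simps)
      next
        case 9
        show ?thesis by (rule J) (simp add: 9 Q5_subst_def gen_ideal_closed)
      qed
    qed
    show "emb_elt d \<in> ?J" unfolding emb_elt_def by (rule gen_ideal_closed(4)[OF gen_ideal_closed(4)[OF t]])
    show "b1 I2 ^ d\<^sup>2 * c1 I2 \<in> ?J" by (rule gen_ideal_closed(4)[OF t])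
  qed
next
  note G = colon_gens_mem[OF colon_gens2_mem(1), where d = d] and t = colon_gens2_mem(2)[of d]
  fix q :: "'a mpoly" assume "q \<in> insert (b1 I2 ^ d\<^sup>2) (Q5_base d)"
  then consider "q = b1 I2 ^ d\<^sup>2" | "q = b1 I1 * c1 I2 - b1 I4 * c1 I3" | "q \<in> Q5_linear d"
    unfolding Q5_base_def by blast
  then show "q * c1 I2 \<in> gen_ideal (colon_gens2 d)"
  proof cases
    case 1
    then show ?thesis using t by simp
  next
    case 2
    show ?thesis unfolding 2 by (rule gen_ideal_comb1[OF G(7), of _ "c1 I2"]) (simp add: algebra_simps)
  next
    case 3
    then show ?thesis
    proof (cases rule: Q5_linear_cases)
      case 1
      show ?thesis unfolding 1
        by (rule gen_ideal_comb2[OF G(4) t, of _ "c1 I2" "c1 I2"]) (simp add: algebra_simps)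
    next
      case 2
      show ?thesis unfolding 2
        by (rule gen_ideal_comb3[OF G(5) G(6) t, of _ "c1 I2" "- c1 I2" "c1 I2"]) (simp add: algebra_simps)
    next
      case 3
      show ?thesis unfolding 3 by (rule gen_ideal_comb1[OF G(8), of _ 1]) (simp add: algebra_simps)
    next
      case 4
      show ?thesis unfolding 4 by (rule gen_ideal_comb1[OF G(1)[of I2], of _ 1]) (simp add: algebra_simps)
    next
      case 5
      show ?thesis unfolding 5 by (rule gen_ideal_comb1[OF G(2)[of I2], of _ 1]) (simp add: algebra_simps)
    qed
  qed
next
  fix p :: "'a mpoly"
  assume "p * c1 I2 \<in> gen_ideal (insert (b1 I2 ^ d\<^sup>2) (Q5_base d))"
  then show "p \<in> gen_ideal (insert (b1 I2 ^ d\<^sup>2) (Q5_base d))"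
    by (rule nonzerodivisor_power[OF prime_Q5_base[of d] b12_notin_Q5_base[of d], unfolded gen_ideal_insert_Q5_base[OF assms],
          OF prime_Q5 c12_notin_Q5])
qed

lemma Ass_quot_colon_Q5:
  assumes "d \<ge> 1"
  shows "Ass_quot {r. r * c1 I2 \<in> gen_ideal (colon_gens2 d)} \<subseteq> {Q5 :: 'a::field mpoly set}"
  unfolding colon_Q5[OF assms]
  using Ass_quot_power[OF prime_Q5_base[of d] b12_notin_Q5_base[of d], unfolded gen_ideal_insert_Q5_base[OF assms], OF prime_Q5] .

section \<open>The prime \<open>Q3\<close> and the colon ideal by \<open>c1 I3\<close>\<close>

definition Q3_base :: "nat \<Rightarrow> 'a::comm_ring_1 mpoly set" where
  "Q3_base d = {c1 I1, c1 I2, c1 I4, b1 I4, b0 I2 - b1 I3 * b0 I3, b0 I1 - b1 I3 ^ d * b0 I4}"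

definition Q3_subst :: "nat \<Rightarrow> var \<Rightarrow> 'a::comm_ring_1 mpoly" where
  "Q3_subst d v = (case v of C1 I3 \<Rightarrow> c1 I3 | C1 _ \<Rightarrow> 0 | B1 I4 \<Rightarrow> 0
     | B0 I1 \<Rightarrow> b1 I3 ^ d * b0 I4 | B0 I2 \<Rightarrow> b1 I3 * b0 I3 | _ \<Rightarrow> Var v)"

lemma Q3_base_cases:
  assumes "s \<in> Q3_base d"
  obtains "s = c1 I1" | "s = c1 I2" | "s = c1 I4" | "s = b1 I4" | "s = b0 I2 - b1 I3 * b0 I3"
    | "s = b0 I1 - b1 I3 ^ d * b0 I4"
  using assms unfolding Q3_base_def by blast

lemma Q3_subst_base: "s \<in> Q3_base d \<Longrightarrow> subst (Q3_subst d) s = 0"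
  by (erule Q3_base_cases) (simp_all add: Q3_subst_def)

lemma Q3_base_mem:
  assumes "Q3_base d \<subseteq> S"
  shows "c1 I1 \<in> gen_ideal S" "c1 I2 \<in> gen_ideal S" "c1 I4 \<in> gen_ideal S" "b1 I4 \<in> gen_ideal S"
    "b0 I2 - b1 I3 * b0 I3 \<in> gen_ideal S" "b0 I1 - b1 I3 ^ d * b0 I4 \<in> gen_ideal S"
  by (rule gen_ideal_base, rule subsetD[OF assms], subst Q3_base_def, blast)+

lemma Q3_subst_cong:
  assumes "Q3_base d \<subseteq> S"
  shows "Var v - Q3_subst d v \<in> gen_ideal S"
  using Q3_base_mem[OF assms]
  by (auto simp: Q3_subst_def gen_ideal_closed split: var.split idx.split)

lemma prime_Q3_base: "prime_ideal (gen_ideal (Q3_base d) :: 'a::field mpoly set)"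
  by (rule prime_retraction[OF Q3_subst_base Q3_subst_cong[OF subset_refl]])

lemma Q3_mem: "c1 I1 \<in> Q3" "c1 I2 \<in> Q3" "c1 I4 \<in> Q3" "b0 I1 \<in> Q3" "b0 I2 \<in> Q3" "b1 I3 \<in> Q3" "b1 I4 \<in> Q3"
  unfolding Q3_def by (rule gen_ideal_base, blast)+

lemma gen_ideal_insert_Q3_base:
  assumes "d \<ge> 1"
  shows "gen_ideal (insert (b1 I3) (Q3_base d)) = (Q3 :: 'a::field mpoly set)"
proof -
  let ?S = "{c1 I1, c1 I2, c1 I4, b0 I1, b0 I2, b1 I3, b1 I4} :: 'a mpoly set"
  note closed = gen_ideal_closed[where S = ?S, folded Q3_def]
  let ?I = "gen_ideal (insert (b1 I3) (Q3_base d)) :: 'a mpoly set"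
  have "b1 I3 ^ d \<in> (Q3 :: 'a mpoly set)"
    unfolding Q3_def by (rule gen_ideal_power[OF _ assms]) (simp add: Q3_def[symmetric] Q3_mem)
  then have "b0 I1 - b1 I3 ^ d * b0 I4 \<in> (Q3 :: 'a mpoly set)" by (rule closed(6)[OF Q3_mem(4) closed(4)])
  moreover have "b0 I2 - b1 I3 * b0 I3 \<in> (Q3 :: 'a mpoly set)" by (rule closed(6)[OF Q3_mem(5) closed(4)[OF Q3_mem(6)]])
  ultimately have "insert (b1 I3) (Q3_base d) \<subseteq> (Q3 :: 'a mpoly set)"
    unfolding Q3_base_def using Q3_mem by blast
  then have "?I \<subseteq> Q3" unfolding Q3_def by (rule gen_ideal_mono)
  moreover
  have "?S \<subseteq> ?I"
  proof -
    have "Q3_base d \<subseteq> insert (b1 I3) (Q3_base d)" by blast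
    note S = Q3_base_mem[OF this]
    have b3: "b1 I3 \<in> ?I" by (rule gen_ideal_base) simp
    have x: "b0 I2 \<in> ?I" by (rule gen_ideal_comb2[OF S(5) b3, of _ 1 "b0 I3"]) simp
    have a: "b0 I1 \<in> ?I"
      by (rule gen_ideal_comb2[OF S(6) gen_ideal_power[OF b3 assms], of _ 1 "b0 I4"]) simp
    show ?thesis using b3 x a S(1-4) by blast
  qed
  then have "Q3 \<subseteq> ?I" unfolding Q3_def by (rule gen_ideal_mono)
  ultimately show ?thesis by (rule subset_antisym)
qed

lemma prime_Q3: "prime_ideal (Q3 :: 'a::field mpoly set)"
proof -
  let ?S = "{c1 I1, c1 I2, c1 I4, b0 I1, b0 I2, b1 I3, b1 I4} :: 'a mpoly set"
  define \<sigma> :: "var \<Rightarrow> 'a mpoly"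
    where "\<sigma> v = (if v \<in> {C1 I1, C1 I2, C1 I4, B0 I1, B0 I2, B1 I3, B1 I4} then 0 else Var v)" for v
  show ?thesis unfolding Q3_def
  proof (rule prime_retraction)
    show "subst \<sigma> s = 0" if "s \<in> ?S" for s using that by (auto simp: \<sigma>_def)
    show "Var v - \<sigma> v \<in> gen_ideal ?S" for v
      by (cases "v \<in> {C1 I1, C1 I2, C1 I4, B0 I1, B0 I2, B1 I3, B1 I4}")
         (auto simp: \<sigma>_def gen_ideal_closed intro: gen_ideal_base)
  qed
qed

lemma b13_notin_Q3_base: "b1 I3 \<notin> gen_ideal (Q3_base d :: 'a::field mpoly set)"
  by (rule notin_gen_ideal[OF Q3_subst_base]) (simp_all add: Q3_subst_def)

lemma c13_notin_Q3: "c1 I3 \<notin> (Q3 :: 'a::field mpoly set)"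
  unfolding Q3_def
  by (rule notin_gen_ideal[of _ "\<lambda>v. if v = C1 I3 then c1 I3 else 0"]) auto

text \<open>Modulo \<open>c1 I2\<close> the relations of \<open>colon_gens d\<close> say that
  \<open>c1 I3\<close> annihilates \<open>b1 I3 ^ d\<^sup>2\<close>, \<open>b1 I4\<close>,
  \<open>c1 I1\<close> and \<open>c1 I4\<close>. Cancellation of \<open>c1 I3\<close> follows from
  \<open>c1 I3\<close> \<notin> \<open>Q3\<close>, as in the case of \<open>Q5\<close>.\<close>

lemma colon_Q3:
  assumes "d \<ge> 1"
  shows "{r. r * c1 I3 \<in> gen_ideal (insert (c1 I2) (colon_gens2 d))}
      = (gen_ideal (insert (b1 I3 ^ d\<^sup>2) (Q3_base d)) :: 'a::field mpoly set)"
proof (rule colon_eqI)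
  let ?J = "gen_ideal (insert (b1 I3 ^ d\<^sup>2) (Q3_base d)) :: 'a mpoly set"
  have t: "b1 I3 ^ d\<^sup>2 \<in> ?J" by (rule gen_ideal_base) simp
  have sub: "Q3_base d \<subseteq> insert (b1 I3 ^ d\<^sup>2) (Q3_base d)" by blast
  note c2 = Q3_base_mem(2)[OF sub]
  have J: "s \<in> ?J" if "subst (Q3_subst d) s \<in> ?J" for s
    using that gen_ideal_cong[OF subst_cong_ideal[OF is_ideal_gen_ideal Q3_subst_cong[OF sub]]] by blast
  have "colon_gens2 d \<subseteq> ?J"
  proof (rule colon_gens2_subset)
    show "colon_gens d \<subseteq> ?J"
    proof
      fix s :: "'a mpoly" assume "s \<in> colon_gens d"
      then show "s \<in> ?J"
      proof (cases rule: colon_gens_cases)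
        case 1
        show ?thesis by (rule J) (simp add: 1 Q3_subst_def power_mult_distrib mult_ac gen_ideal_closed)
      next
        case (2 i)
        show ?thesis by (rule J, cases i) (simp_all add: 2 Q3_subst_def gen_ideal_closed)
      next
        case (3 i)
        show ?thesis by (rule J, cases i) (simp_all add: 3 Q3_subst_def gen_ideal_closed)
      next
        case (4 i j)
        show ?thesis by (rule J, cases i; cases j) (simp_all add: 4 Q3_subst_def gen_ideal_closed)
      next
        case 5
        show ?thesis by (rule J) (simp add: 5 Q3_subst_def gen_ideal_closed)
      next
        case 6
        show ?thesis by (rule J, rule gen_ideal_comb1[OF t, of _ "- c1 I3"]) (simp add: 6 Q3_subst_def)
      next
        case 7
        show ?thesis by (rule J, rule gen_ideal_comb1[OF t, of _ "- c1 I3"]) (simp add: 7 Q3_subst_def)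
      next
        case 8
        show ?thesis by (rule J) (simp add: 8 Q3_subst_def gen_ideal_closed)
      next
        case 9
        show ?thesis by (rule J) (simp add: 9 Q3_subst_def gen_ideal_closed)
      qed
    qed
    show "emb_elt d \<in> ?J" unfolding emb_elt_def by (rule gen_ideal_closed(4)[OF gen_ideal_closed(3)[OF c2]])
    show "b1 I2 ^ d\<^sup>2 * c1 I2 \<in> ?J" by (rule gen_ideal_closed(3)[OF c2])
  qed
  then show "insert (c1 I2) (colon_gens2 d) \<subseteq> ?J" using c2 by blast
next
  let ?I = "gen_ideal (insert (c1 I2) (colon_gens2 d)) :: 'a mpoly set"
  have sub: "colon_gens d \<subseteq> insert (c1 I2) (colon_gens2 d)" using colon_gens2_mem(1) by blast
  note G = colon_gens_mem[OF sub]
  have c2: "c1 I2 \<in> ?I" by (rule gen_ideal_base) simp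
  fix q :: "'a mpoly" assume "q \<in> insert (b1 I3 ^ d\<^sup>2) (Q3_base d)"
  then consider "q = b1 I3 ^ d\<^sup>2" | "q \<in> Q3_base d" by blast
  then show "q * c1 I3 \<in> ?I"
  proof cases
    case 1
    show ?thesis unfolding 1
      by (rule gen_ideal_comb2[OF G(6) c2, of _ "- 1" "b1 I2 ^ d\<^sup>2"]) (simp add: algebra_simps)
  next
    case 2
    then show ?thesis
    proof (cases rule: Q3_base_cases)
      case 1
      show ?thesis unfolding 1
        by (rule gen_ideal_comb2[OF G(4) c2, of _ "c1 I3" "b1 I2 ^ d\<^sup>2 * c1 I3"]) (simp add: algebra_simps)
    next
      case 2
      show ?thesis unfolding 2 by (rule gen_ideal_closed(4)[OF c2])
    next
      case 3
      show ?thesis unfolding 3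
        by (rule gen_ideal_comb3[OF G(5) G(6) c2, of _ "c1 I3" "- c1 I3" "b1 I2 ^ d\<^sup>2 * c1 I3"])
           (simp add: algebra_simps)
    next
      case 4
      show ?thesis unfolding 4
        by (rule gen_ideal_comb2[OF G(7) c2, of _ "- 1" "b1 I1"]) (simp add: algebra_simps)
    next
      case 5
      show ?thesis unfolding 5 by (rule gen_ideal_comb1[OF G(1)[of I3], of _ 1]) (simp add: algebra_simps)
    next
      case 6
      show ?thesis unfolding 6 by (rule gen_ideal_comb1[OF G(2)[of I3], of _ 1]) (simp add: algebra_simps)
    qed
  qed
next
  fix p :: "'a mpoly"
  assume "p * c1 I3 \<in> gen_ideal (insert (b1 I3 ^ d\<^sup>2) (Q3_base d))"
  then show "p \<in> gen_ideal (insert (b1 I3 ^ d\<^sup>2) (Q3_base d))"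
    by (rule nonzerodivisor_power[OF prime_Q3_base[of d] b13_notin_Q3_base[of d], unfolded gen_ideal_insert_Q3_base[OF assms],
          OF prime_Q3 c13_notin_Q3])
qed

lemma Ass_quot_colon_Q3:
  assumes "d \<ge> 1"
  shows "Ass_quot {r. r * c1 I3 \<in> gen_ideal (insert (c1 I2) (colon_gens2 d))} \<subseteq> {Q3 :: 'a::field mpoly set}"
  unfolding colon_Q3[OF assms]
  using Ass_quot_power[OF prime_Q3_base[of d] b13_notin_Q3_base[of d], unfolded gen_ideal_insert_Q3_base[OF assms], OF prime_Q3] .

section \<open>The top of the chain and the assembly of the bounds\<close>

lemma gen_ideal_chain_top:
  "gen_ideal (insert (c1 I3) (insert (c1 I2) (colon_gens2 d))) = (Q2 d :: 'a::field mpoly set)"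
  unfolding Q2_def
proof (rule gen_ideal_eqI)
  let ?Q = "gen_ideal (C1set \<union> {b0 I1 * b0 I3 ^ d - b0 I4 * b0 I2 ^ d}) :: 'a mpoly set"
  let ?I = "gen_ideal (insert (c1 I3) (insert (c1 I2) (colon_gens2 d))) :: 'a mpoly set"
  have c: "c1 i \<in> ?Q" for i
    by (cases i; rule gen_ideal_base, simp add: C1set_def)
  have "s \<in> ?Q" if "s \<in> colon_gens d" for s
    using that
  proof (cases rule: colon_gens_cases)
    case 1
    show ?thesis unfolding 1 by (rule gen_ideal_base) simp
  next
    case 2
    show ?thesis unfolding 2 by (rule gen_ideal_closed(4)[OF c])
  next
    case 3
    show ?thesis unfolding 3 by (rule gen_ideal_closed(4)[OF c])
  next
    case 4
    show ?thesis unfolding 4 by (rule gen_ideal_closed(4)[OF gen_ideal_closed(4)[OF c]])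
  next
    case 5
    show ?thesis unfolding 5 by (rule gen_ideal_closed(6)[OF c gen_ideal_closed(3)[OF c]])
  next
    case 6
    show ?thesis unfolding 6 by (rule gen_ideal_closed(6)[OF c gen_ideal_closed(3)[OF c]])
  next
    case 7
    show ?thesis unfolding 7 by (rule gen_ideal_closed(6)[OF gen_ideal_closed(3)[OF c] gen_ideal_closed(3)[OF c]])
  next
    case 8
    show ?thesis unfolding 8 by (rule gen_ideal_closed(6)[OF gen_ideal_closed(4)[OF c] gen_ideal_closed(4)[OF c]])
  next
    case 9
    show ?thesis unfolding 9 by (rule gen_ideal_closed(4)[OF c])
  qed
  moreover have "emb_elt d \<in> ?Q" unfolding emb_elt_def by (rule gen_ideal_closed(4)[OF gen_ideal_closed(3)[OF c]])
  moreover have "b1 I2 ^ d\<^sup>2 * c1 I2 \<in> ?Q" by (rule gen_ideal_closed(3)[OF c])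
  ultimately have "colon_gens2 d \<subseteq> ?Q" by (intro colon_gens2_subset) auto
  then show "insert (c1 I3) (insert (c1 I2) (colon_gens2 d)) \<subseteq> ?Q" using c by blast
  have c23: "c1 I2 \<in> ?I" "c1 I3 \<in> ?I" by (rule gen_ideal_base, simp)+
  have sub: "colon_gens d \<subseteq> insert (c1 I3) (insert (c1 I2) (colon_gens2 d :: 'a mpoly set))" using colon_gens2_mem(1) by blast
  note G = colon_gens_mem[OF sub]
  \<comment> \<open>The elements \<open>c1 I1\<close> and \<open>c1 I4\<close> are multiples of
    \<open>c1 I2\<close> and \<open>c1 I3\<close> modulo \<open>colon_gens d\<close>, so adjoining
    the latter two yields all four.\<close>
  have "c1 I1 \<in> ?I" by (rule gen_ideal_comb2[OF G(4) c23(1), of _ 1 "b1 I2 ^ d\<^sup>2"]) simp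
  moreover have "c1 I4 \<in> ?I" by (rule gen_ideal_comb2[OF G(5) c23(2), of _ 1 "b1 I3 ^ d\<^sup>2"]) simp
  moreover have "b0 I1 * b0 I3 ^ d - b0 I4 * b0 I2 ^ d \<in> ?I"
    by (rule gen_ideal_base, rule subsetD[OF sub]) (simp add: colon_gens_def K_base_gens_def)
  ultimately show "C1set \<union> {b0 I1 * b0 I3 ^ d - b0 I4 * b0 I2 ^ d} \<subseteq> ?I"
    using c23 unfolding C1set_def by blast
qed

text \<open>Descent from the top \<open>Q2 d\<close>: removing in turn \<open>c1 I3\<close>,
  \<open>c1 I2\<close>, \<open>b1 I2 ^ d\<^sup>2 * c1 I2\<close> and \<open>emb_elt d\<close>, each
  application of \<open>Ass_quot_gen_insert\<close> adds only the associated primes of one known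
  colon ideal.\<close>

lemma Ass_quot_colon_gens:
  assumes "alg_closed TYPE('a::field)" "d \<ge> 1"
  shows "Ass_quot (gen_ideal (colon_gens d :: 'a mpoly set))
      \<subseteq> {Q2 d, Q3, Q5, Q17_2 d, Q20} \<union> {Q19 d \<alpha> | \<alpha>. \<alpha> ^ d = 1}"
proof -
  let ?X = "{Q2 d, Q3, Q5, Q17_2 d, Q20} \<union> {Q19 d \<alpha> | \<alpha>. \<alpha> ^ d = 1} :: 'a mpoly set set"
  have "Ass_quot (gen_ideal (insert (c1 I3) (insert (c1 I2) (colon_gens2 d)))) \<subseteq> ?X"
    unfolding gen_ideal_chain_top using Ass_quot_prime[OF prime_Q2[OF assms(2), where 'a = 'a]] by blast
  moreover have "Ass_quot {r. r * c1 I3 \<in> gen_ideal (insert (c1 I2) (colon_gens2 d))} \<subseteq> ?X"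
    using Ass_quot_colon_Q3[OF assms(2), where 'a = 'a] by blast
  ultimately have "Ass_quot (gen_ideal (insert (c1 I2) (colon_gens2 d))) \<subseteq> ?X"
    by - (rule subset_trans[OF Ass_quot_gen_insert[of _ "c1 I3"] Un_least])
  moreover have "Ass_quot {r. r * c1 I2 \<in> gen_ideal (colon_gens2 d)} \<subseteq> ?X"
    using Ass_quot_colon_Q5[OF assms(2), where 'a = 'a] by blast
  ultimately have "Ass_quot (gen_ideal (colon_gens2 d)) \<subseteq> ?X"
    by - (rule subset_trans[OF Ass_quot_gen_insert[of _ "c1 I2"] Un_least])
  moreover have "Ass_quot {r. r * (b1 I2 ^ d\<^sup>2 * c1 I2) \<in> gen_ideal (insert (emb_elt d) (colon_gens d))} \<subseteq> ?X"
    unfolding colon_Q17[OF assms(2)]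
    using Ass_quot_prime[OF Q17_retraction(1)[where 'a = 'a and d = d]] by blast
  ultimately have "Ass_quot (gen_ideal (insert (emb_elt d) (colon_gens d))) \<subseteq> ?X"
    unfolding colon_gens2_def
    by - (rule subset_trans[OF Ass_quot_gen_insert[of _ "b1 I2 ^ d\<^sup>2 * c1 I2"] Un_least])
  moreover have "Ass_quot {r. r * emb_elt d \<in> gen_ideal (colon_gens d)} \<subseteq> ?X"
    using Ass_quot_colon_emb_elt[OF assms] by blast
  ultimately show ?thesis
    by - (rule subset_trans[OF Ass_quot_gen_insert[of _ "emb_elt d"] Un_least])
qed

theorem theorem2p7:
  fixes d :: nat
  assumes "alg_closed TYPE('a::field)"
    and "d \<ge> 2"
    and "\<not> CHAR('a) dvd d"
  shows "Ass_quot (K2 d :: 'a mpoly set) \<subseteq>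
           {Q1 L | L. L \<noteq> {}}
         \<union> {Q2 d, Q3, Q5, Q17_2 d, Q18_2 d, Q20}
         \<union> {Q19 d \<alpha> | \<alpha>. \<alpha> ^ d = 1}"
proof -
  have "d \<ge> 1" using assms(2) by simp
  then show ?thesis
    using Ass_quot_K2[of d, where 'a = 'a] Ass_quot_colon_gens[OF assms(1), of d] by blast
qed

end
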